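(* Assume that $\mathbf{P}$ is perfect, i.e. $\mathbf{P}$ has no isolated points. Let $(A,B) \in C_{n,n}(\mathbf{P}) \times X_{n,m}(\mathbf{P})$ and suppose that the pair $(A,B)$ is not exponentially stable (i.e. the uncontrolled system $\dot x(t)=\mathcal{A}x(t)$ on $X_n(\mathbf{P})$ is not exponentially stable). Then it is not exponentially stabilizable by ensemble feedback, i.e., for every bounded linear operator $\mathcal{F}: X_n(\mathbf{P}) \to \mathbb{C}^m$ the closed-loop system $\dot x(t)=(\mathcal{A}+\mathcal{B}\mathcal{F})x(t)$ is not exponentially stable.
   Context: $\mathbf{P}\subset\mathbb{C}$ is a nonempty compact set. $C(\mathbf{P})$ is the space of continuous functions $\mathbf{P}\to\mathbb{C}$ and $C_{n,m}(\mathbf{P})$ the space of $n\times m$ matrices with entries in $C(\mathbf{P})$. $X(\mathbf{P})$ is a separable Banach space of functions $\mathbf{P}\to\mathbb{C}$, $X_{n,m}(\mathbf{P})$ is the space of $n\times m$ matrices with entries in $X(\mathbf{P})$, and $X_n(\mathbf{P})=X_{n,1}(\mathbf{P})$ is the Banach space of $\mathbb{C}^n$-valued functions with norm $\|x\|=\max_{1\le i\le n}\|x_i\|_{X(\mathbf{P})}$. It is assumed that for every $A\in C_{n,n}(\mathbf{P})$ the multiplication operator $\mathcal{A}:X_n(\mathbf{P})\to X_n(\mathbf{P})$, $(\mathcal{A}f)(\theta)=A(\theta)f(\theta)$, is a well-defined bounded linear operator. For $B\in X_{n,m}(\mathbf{P})$, $\mathcal{B}:\mathbb{C}^m\to X_n(\mathbf{P})$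 is the bounded linear operator $(\mathcal{B}v)(\theta)=B(\theta)v$. For a bounded operator $\mathcal{G}$ on $X_n(\mathbf{P})$, the system $\dot x=\mathcal{G}x$ is exponentially stable if there are constants $M\ge 1$ and $\gamma>0$ with $\|e^{t\mathcal{G}}\|\le Me^{-\gamma t}$ for all $t\ge0$.
   Formalization: Adds the assumption that the points of P at which some function in X(P) is nonzero are dense in P; without it the claim fails, e.g. P=[0,1], X(P) the functions vanishing off {0} with norm |f(0)|, n=m=1, A=1, B the indicator of {0}, Ff=-2f(0). *)

theory Defs
  imports "HOL-Analysis.Analysis"
begin

section \<open>Complex normed spaces\<close>

class complex_normed_vector = real_normed_vector +
  fixes scaleC :: "complex \<Rightarrow> 'a \<Rightarrow> 'a"  (infixr "*\<^sub>C" 75)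
  assumes scaleC_add_right: "c *\<^sub>C (x + y) = c *\<^sub>C x + c *\<^sub>C y"
    and scaleC_add_left: "(c + d) *\<^sub>C x = c *\<^sub>C x + d *\<^sub>C x"
    and scaleC_scaleC: "c *\<^sub>C (d *\<^sub>C x) = (c * d) *\<^sub>C x"
    and scaleC_of_real: "complex_of_real r *\<^sub>C x = r *\<^sub>R x"
    and norm_scaleC: "norm (c *\<^sub>C x) = cmod c * norm x"

instantiation complex :: complex_normed_vector
begin

definition scaleC_complex :: "complex \<Rightarrow> complex \<Rightarrow> complex"
  where "scaleC_complex c x = c * x"

instance
  by standard (simp_all add: scaleC_complex_def algebra_simps norm_mult scaleR_conv_of_real)

end

instantiation vec :: (complex_normed_vector, finite) complex_normed_vector
begin

definition scaleC_vec :: "complex \<Rightarrow> 'a ^ 'b \<Rightarrow> 'a ^ 'b"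
  where "scaleC_vec c x = (\<chi> i. c *\<^sub>C (x $ i))"

instance
proof
  fix c :: complex and x :: "'a ^ 'b"
  show "norm (c *\<^sub>C x) = cmod c * norm x"
    by (simp add: scaleC_vec_def norm_vec_def norm_scaleC L2_set_right_distrib)
qed (simp_all add: scaleC_vec_def vec_eq_iff scaleC_add_right scaleC_add_left
       scaleC_scaleC scaleC_of_real)

end

definition bounded_clinear ::
    "('a::complex_normed_vector \<Rightarrow> 'b::complex_normed_vector) \<Rightarrow> bool"
  where "bounded_clinear T \<longleftrightarrow> bounded_linear T \<and> (\<forall>c x. T (c *\<^sub>C x) = c *\<^sub>C T x)"


section \<open>Banach spaces of functions\<close>

text \<open>
  A separable complex Banach space of functions from \<open>P\<close> to the complex numbers is given by a
  type \<open>'x\<close> together with \<open>ev\<close>, where \<open>ev f \<theta>\<close> is the value at \<open>\<theta>\<close> of the function \<open>f\<close>. The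
  operations are pointwise and a vector is determined by its values on \<open>P\<close>; values outside \<open>P\<close>
  are irrelevant, and point evaluation is not required to be continuous. For a metric space,
  the class \<open>second_countable_topology\<close> amounts to separability.
\<close>

locale separable_banach_function_space =
  fixes P :: "complex set"
    and ev :: "'x::{complex_normed_vector, banach, second_countable_topology} \<Rightarrow> complex \<Rightarrow> complex"
  assumes ev_add: "\<theta> \<in> P \<Longrightarrow> ev (f + g) \<theta> = ev f \<theta> + ev g \<theta>"
    and ev_scaleC: "\<theta> \<in> P \<Longrightarrow> ev (c *\<^sub>C f) \<theta> = c * ev f \<theta>"
    and ev_inject: "(\<And>\<theta>. \<theta> \<in> P \<Longrightarrow> ev f \<theta> = ev g \<theta>) \<Longrightarrow> f = g"

definition vec_ev :: "('x \<Rightarrow> complex \<Rightarrow> complex) \<Rightarrow> 'x ^ 'n \<Rightarrow> complex \<Rightarrow> complex ^ 'n"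
  where "vec_ev ev f \<theta> = (\<chi> i. ev (f $ i) \<theta>)"

definition mat_ev :: "('x \<Rightarrow> complex \<Rightarrow> complex) \<Rightarrow> 'x ^ 'm ^ 'n \<Rightarrow> complex \<Rightarrow> complex ^ 'm ^ 'n"
  where "mat_ev ev B \<theta> = (\<chi> i j. ev (B $ i $ j) \<theta>)"

text \<open>
  The type \<open>'x ^ 'n\<close> carries the Euclidean combination of the component norms. The norm used
  for vector-valued functions is the maximum of the component norms; it is equivalent to the
  Euclidean one, so that boundedness and convergence may be taken in either.
\<close>

definition norm_max :: "('x::real_normed_vector) ^ 'n \<Rightarrow> real"
  where "norm_max x = Max (range (\<lambda>i. norm (x $ i)))"

definition onorm_max :: "('x::real_normed_vector ^ 'n \<Rightarrow> 'x ^ 'n) \<Rightarrow> real"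
  where "onorm_max T = (SUP x. norm_max (T x) / norm_max x)"


section \<open>The operators of an ensemble\<close>

definition mult_op ::
    "complex set \<Rightarrow> ('x \<Rightarrow> complex \<Rightarrow> complex) \<Rightarrow> (complex \<Rightarrow> complex ^ 'n ^ 'n)
      \<Rightarrow> 'x ^ 'n \<Rightarrow> 'x ^ 'n"
  where "mult_op P ev A f = (THE g. \<forall>\<theta>\<in>P. vec_ev ev g \<theta> = A \<theta> *v vec_ev ev f \<theta>)"

definition bounded_multiplier ::
    "complex set \<Rightarrow> ('x::complex_normed_vector \<Rightarrow> complex \<Rightarrow> complex)
      \<Rightarrow> (complex \<Rightarrow> complex ^ 'n ^ 'n) \<Rightarrow> bool"
  where "bounded_multiplier P ev A \<longleftrightarrow>
    (\<forall>f. \<exists>g. \<forall>\<theta>\<in>P. vec_ev ev g \<theta> = A \<theta> *v vec_ev ev f \<theta>) \<and> bounded_clinear (mult_op P ev A)"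

definition control_op :: "('x::complex_normed_vector) ^ 'm ^ 'n \<Rightarrow> complex ^ 'm \<Rightarrow> 'x ^ 'n"
  where "control_op B v = (\<chi> i. \<Sum>j\<in>UNIV. (v $ j) *\<^sub>C (B $ i $ j))"

context separable_banach_function_space
begin

lemma ev_zero: "\<theta> \<in> P \<Longrightarrow> ev 0 \<theta> = 0"
  using ev_add[of \<theta> 0 0] by simp

lemma ev_sum: "\<theta> \<in> P \<Longrightarrow> ev (sum f S) \<theta> = (\<Sum>j\<in>S. ev (f j) \<theta>)"
  by (induction S rule: infinite_finite_induct) (simp_all add: ev_zero ev_add)

lemma vec_ev_inject:
  assumes "\<And>\<theta>. \<theta> \<in> P \<Longrightarrow> vec_ev ev f \<theta> = vec_ev ev g \<theta>"
  shows "f = g"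
  using assms by (auto simp: vec_ev_def vec_eq_iff intro: ev_inject)

lemma vec_ev_mult_op:
  assumes "bounded_multiplier P ev A" and "\<theta> \<in> P"
  shows "vec_ev ev (mult_op P ev A f) \<theta> = A \<theta> *v vec_ev ev f \<theta>"
proof -
  have "\<exists>!g. \<forall>\<theta>\<in>P. vec_ev ev g \<theta> = A \<theta> *v vec_ev ev f \<theta>"
  proof (rule ex_ex1I)
    show "\<exists>g. \<forall>\<theta>\<in>P. vec_ev ev g \<theta> = A \<theta> *v vec_ev ev f \<theta>"
      using assms(1) by (auto simp: bounded_multiplier_def)
  qed (auto intro: vec_ev_inject)
  from theI'[OF this] show ?thesis
    using assms(2) by (simp add: mult_op_def)
qed

lemma vec_ev_control_op:
  "\<theta> \<in> P \<Longrightarrow> vec_ev ev (control_op B v) \<theta> = mat_ev ev B \<theta> *v v"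
  by (simp add: vec_ev_def mat_ev_def control_op_def matrix_vector_mult_def vec_eq_iff
      ev_sum ev_scaleC mult.commute)

end


section \<open>Exponential stability\<close>

text \<open>The exponential series of \<open>t G\<close>, applied to a vector; for bounded \<open>G\<close> on a Banach space
  it converges absolutely.\<close>

definition exp_op :: "real \<Rightarrow> ('a::real_normed_vector \<Rightarrow> 'a) \<Rightarrow> 'a \<Rightarrow> 'a"
  where "exp_op t G x = (\<Sum>k. (t ^ k / fact k) *\<^sub>R (G ^^ k) x)"

definition exponentially_stable :: "('x::real_normed_vector ^ 'n \<Rightarrow> 'x ^ 'n) \<Rightarrow> bool"
  where "exponentially_stable G \<longleftrightarrow>
    (\<exists>M\<ge>1. \<exists>\<gamma>>0. \<forall>t\<ge>0. onorm_max (exp_op t G) \<le> M * exp (- \<gamma> * t))"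

definition exponentially_stabilizable ::
    "complex set \<Rightarrow> ('x::complex_normed_vector \<Rightarrow> complex \<Rightarrow> complex)
      \<Rightarrow> (complex \<Rightarrow> complex ^ 'n ^ 'n) \<Rightarrow> 'x ^ 'm ^ 'n \<Rightarrow> bool"
  where "exponentially_stabilizable P ev A B \<longleftrightarrow>
    (\<exists>F :: 'x ^ 'n \<Rightarrow> complex ^ 'm. bounded_clinear F \<and>
      exponentially_stable (\<lambda>x. mult_op P ev A x + control_op B (F x)))"

text \<open>
  For a space of functions on \<open>P\<close>, the points at which some member is nonzero should be dense
  in \<open>P\<close>. Otherwise the space effectively lives on a smaller set, which may have isolated points
  even if \<open>P\<close> has none: on the unit interval, the functions vanishing off the point \<open>0\<close> form a
  one-dimensional Banach space on which all continuous multipliers are bounded, and there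
  \<open>A = 1\<close> is stabilized by a scalar feedback.
\<close>

definition nonvanishing_densely :: "complex set \<Rightarrow> ('x \<Rightarrow> complex \<Rightarrow> complex) \<Rightarrow> bool"
  where "nonvanishing_densely P ev \<longleftrightarrow> P \<subseteq> closure {\<theta>\<in>P. \<exists>f. ev f \<theta> \<noteq> 0}"

end

theory Submission
  imports Defs "HOL-Computational_Algebra.Fundamental_Theorem_Algebra"
begin

text \<open>
  Two facts carry the proof. First, if every eigenvalue of every matrix \<open>A(\<theta>)\<close> has negative real
  part, then the multiplication operator is exponentially stable
  (\<open>exponentially_stable_of_eigenvalues\<close>). Hence an unstable ensemble has a point \<open>\<theta>0\<close> of \<open>P\<close> and an
  eigenvalue \<open>l0\<close> of \<open>A(\<theta>0)\<close> with \<open>Re l0 \<ge> 0\<close>. Second, no feedback of finite rank removes such an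
  eigenvalue when \<open>\<theta>0\<close> is a limit point of \<open>P\<close> (\<open>closed_loop_not_stable\<close>).

  For the first fact, \<open>l - A\<close> is invertible by means of the continuous multiplier
  \<open>(l - A(\<theta>))\<^sup>-\<^sup>1\<close> for all \<open>l\<close> in a half plane \<open>Re l \<ge> -d\<close> with \<open>d > 0\<close>. The passage from this
  spectral information to decay of the semigroup takes place in an abstract complex Banach algebra
  (\<open>exp_decay\<close>). It never uses the exponential of the matrices \<open>A(\<theta>)\<close>: point evaluations may be
  discontinuous, the homomorphism that sends a continuous matrix function to its multiplication
  operator is only known to be algebraic, and so it is unclear whether the semigroup of \<open>A\<close> is
  multiplication by \<open>exp (t A(\<theta>))\<close>. Only algebraic identities between multipliers are used.

  For the second fact, suppose that the closed loop \<open>T = A + B F\<close> is exponentially stable. Then its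
  resolvent \<open>R(l)\<close> exists and is continuous in \<open>l\<close> on a half plane that contains \<open>l0\<close>
  (\<open>resolvent_of_exp_decay\<close>). Eigenvalues depend continuously on the matrix, so there are points
  \<open>\<theta>\<^sub>k \<noteq> \<theta>0\<close> tending to \<open>\<theta>0\<close>, at each of which some function of the space is nonzero, and eigenvalues \<open>l\<^sub>k\<close> of \<open>A(\<theta>\<^sub>k)\<close> tending to \<open>l0\<close>; let \<open>w\<^sub>k\<close> be a left
  eigenvector. Applying \<open>w\<^sub>k\<close> at \<open>\<theta>\<^sub>k\<close> to the equation \<open>g = (l\<^sub>k - A - B F) R(l\<^sub>k) g\<close> cancels the first two
  terms and leaves \<open>w\<^sub>k \<cdot> g(\<theta>\<^sub>k) = - b\<^sub>k \<cdot> F R(l\<^sub>k) g\<close> with \<open>b\<^sub>k = w\<^sub>k B(\<theta>\<^sub>k)\<close>. Thus these evaluation functionals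
  are continuous and are parametrised by the finite-dimensional vectors \<open>b\<^sub>k\<close>. After normalisation
  a subsequence of them converges in norm to a nonzero functional \<open>z \<cdot> F R(l0)\<close>. But functionals
  living at points \<open>\<theta>\<^sub>k \<noteq> \<theta>0\<close> that tend to \<open>\<theta>0\<close> can converge in norm to zero only
  (\<open>limit_of_characters_vanishes\<close>).
\<close>

section \<open>Boundedness of powers in complex Banach algebras\<close>

class complex_banach_algebra = complex_normed_vector + real_normed_algebra_1 + banach +
  assumes mult_scaleC_left: "(c *\<^sub>C x) * y = c *\<^sub>C (x * y)"
    and mult_scaleC_right: "x * (c *\<^sub>C y) = c *\<^sub>C (x * y)"

lemma scaleC_one [simp]: "1 *\<^sub>C (x :: 'a :: complex_normed_vector) = x"
  using scaleC_of_real[of 1 x] by simp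

lemma scaleC_zero_left [simp]: "0 *\<^sub>C (x :: 'a :: complex_normed_vector) = 0"
  using scaleC_of_real[of 0 x] by simp

lemma scaleC_zero_right [simp]: "c *\<^sub>C (0 :: 'a :: complex_normed_vector) = 0"
  using scaleC_add_right[of c 0 "0::'a"] by simp

lemma scaleC_minus_left: "(- c) *\<^sub>C (x :: 'a :: complex_normed_vector) = - (c *\<^sub>C x)"
  using scaleC_add_left[of c "-c" x] by (simp add: eq_neg_iff_add_eq_0 add.commute)

lemma scaleC_minus_right: "c *\<^sub>C (- x :: 'a :: complex_normed_vector) = - (c *\<^sub>C x)"
  using scaleC_add_right[of c x "-x"] by (simp add: eq_neg_iff_add_eq_0 add.commute)

lemma scaleC_diff_left: "(c - d) *\<^sub>C (x :: 'a :: complex_normed_vector) = c *\<^sub>C x - d *\<^sub>C x"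
  using scaleC_add_left[of c "-d" x] by (simp add: scaleC_minus_left)

lemma scaleC_diff_right: "c *\<^sub>C (x - y :: 'a :: complex_normed_vector) = c *\<^sub>C x - c *\<^sub>C y"
  using scaleC_add_right[of c x "-y"] by (simp add: scaleC_minus_right)

lemma scaleC_sum_right:
  "c *\<^sub>C (\<Sum>i\<in>S. f i :: 'a :: complex_normed_vector) = (\<Sum>i\<in>S. c *\<^sub>C f i)"
  by (induction S rule: infinite_finite_induct) (simp_all add: scaleC_add_right)

lemma scaleC_sum_left:
  "(\<Sum>i\<in>S. f i) *\<^sub>C (x :: 'a :: complex_normed_vector) = (\<Sum>i\<in>S. f i *\<^sub>C x)"
  by (induction S rule: infinite_finite_induct) (simp_all add: scaleC_add_left)

lemma scaleR_scaleC: "r *\<^sub>R (x :: 'a :: complex_normed_vector) = complex_of_real r *\<^sub>C x"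
  by (simp add: scaleC_of_real)

lemma bounded_bilinear_scaleC:
  "bounded_bilinear (scaleC :: complex \<Rightarrow> 'a \<Rightarrow> 'a :: complex_normed_vector)"
proof
  show "\<exists>K. \<forall>a (b::'a). norm (a *\<^sub>C b) \<le> norm a * norm b * K"
    by (intro exI[of _ 1]) (simp add: norm_scaleC)
qed (simp_all add: scaleC_add_left scaleC_add_right scaleR_scaleC scaleC_scaleC
       scaleC_complex_def mult.commute)

lemma power_scaleC: "(c *\<^sub>C (x :: 'a :: complex_banach_algebra)) ^ n = c ^ n *\<^sub>C x ^ n"
  by (induction n) (simp_all add: mult_scaleC_left mult_scaleC_right scaleC_scaleC mult.commute)

definition inverse_pair :: "'a :: monoid_mult \<Rightarrow> 'a \<Rightarrow> bool"
  where "inverse_pair a b \<longleftrightarrow> a * b = 1 \<and> b * a = 1"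

lemma inverse_pair_scaleC:
  fixes a :: "'a :: complex_banach_algebra"
  assumes "inverse_pair a b" "c \<noteq> 0"
  shows "inverse_pair (c *\<^sub>C a) (inverse c *\<^sub>C b)"
  using assms by (simp add: inverse_pair_def mult_scaleC_left mult_scaleC_right scaleC_scaleC)

lemma neumann:
  fixes x :: "'a :: {real_normed_algebra_1, banach}"
  assumes "norm x < 1"
  shows "\<exists>b. inverse_pair (1 - x) b"
proof -
  have s: "summable (\<lambda>n. x ^ n)"
    using assms by (rule complete_algebra_summable_geometric)
  have 1: "(\<lambda>n. x ^ n - x ^ Suc n) sums (x ^ 0 - 0)"
    by (rule telescope_sums') (rule summable_LIMSEQ_zero[OF s])
  have "(\<lambda>n. (1 - x) * x ^ n) sums ((1 - x) * (\<Sum>n. x ^ n))"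
    by (intro sums_mult summable_sums s)
  with 1 have "(1 - x) * (\<Sum>n. x ^ n) = 1"
    by (simp add: left_diff_distrib sums_iff)
  moreover have "(\<lambda>n. x ^ n * (1 - x)) sums ((\<Sum>n. x ^ n) * (1 - x))"
    by (intro sums_mult2 summable_sums s)
  with 1 have "(\<Sum>n. x ^ n) * (1 - x) = 1"
    by (simp add: right_diff_distrib sums_iff power_commutes)
  ultimately show ?thesis
    by (auto simp: inverse_pair_def)
qed

text \<open>
  The identity \<open>g x - b = g x * (a - f x) * b\<close> shows that \<open>g x\<close> stays bounded, and then
  that the difference tends to 0.
\<close>

lemma inverse_pair_tendsto:
  fixes f g :: "'b \<Rightarrow> 'a :: real_normed_algebra_1"
  assumes lim: "(f \<longlongrightarrow> a) F" and ab: "inverse_pair a b"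
    and fg: "\<forall>\<^sub>F x in F. inverse_pair (f x) (g x)"
  shows "(g \<longlongrightarrow> b) F"
proof -
  have "((\<lambda>x. norm (a - f x) * norm b) \<longlongrightarrow> norm (a - a) * norm b) F"
    by (intro tendsto_intros lim)
  then have small: "\<forall>\<^sub>F x in F. norm (a - f x) * norm b < 1 / 2"
    by (rule order_tendstoD) simp
  have diff: "g x - b = g x * (a - f x) * b" if "inverse_pair (f x) (g x)" for x
  proof -
    have "g x * (a - f x) * b = g x * (a * b) - (g x * f x) * b"
      by (simp add: algebra_simps)
    then show ?thesis
      using that ab by (simp add: inverse_pair_def)
  qed
  have bound: "\<forall>\<^sub>F x in F. norm (g x - b) \<le> (2 * norm b) * (norm (a - f x) * norm b)"
    using small fg
  proof eventually_elim
    case (elim x)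
    have d: "norm (g x - b) \<le> norm (g x) * (norm (a - f x) * norm b)"
      unfolding diff[OF elim(2)]
      by (metis (no_types, lifting) mult.assoc mult_left_mono norm_ge_zero norm_mult_ineq order_trans)
    also have "\<dots> \<le> norm (g x) * (1 / 2)"
      using elim by (intro mult_left_mono) auto
    finally have "norm (g x) \<le> 2 * norm b"
      using norm_triangle_ineq2[of "g x" b] by simp
    then have "norm (g x) * (norm (a - f x) * norm b) \<le> (2 * norm b) * (norm (a - f x) * norm b)"
      by (intro mult_right_mono) auto
    with d show ?case by linarith
  qed
  have "((\<lambda>x. (2 * norm b) * (norm (a - f x) * norm b)) \<longlongrightarrow>
      (2 * norm b) * (norm (a - a) * norm b)) F"
    by (intro tendsto_intros lim)
  then have "((\<lambda>x. (2 * norm b) * (norm (a - f x) * norm b)) \<longlongrightarrow> 0) F"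
    by simp
  with bound have "((\<lambda>x. g x - b) \<longlongrightarrow> 0) F"
    by (rule Lim_null_comparison)
  then show ?thesis
    by (simp add: LIM_zero_iff)
qed

lemma cis_root_of_unity: "0 < N \<Longrightarrow> cis (2 * pi / real N) ^ N = 1"
  by (simp add: Complex.DeMoivre)

lemma sum_powers_root_of_unity:
  assumes "0 < N" "j < N"
  shows "(\<Sum>k<N. (cis (2 * pi / N) ^ k) ^ j) = (if j = 0 then of_nat N else 0)"
proof (cases "j = 0")
  case False
  let ?w = "cis (2 * pi / N)"
  have "?w ^ N = 1"
    using assms by (simp add: cis_root_of_unity)
  have "?w ^ j \<noteq> 1"
  proof
    assume "?w ^ j = 1"
    then have "cis (real j * (2 * pi / N)) = 1"
      by (simp add: Complex.DeMoivre)
    then have "cos (real j * (2 * pi / N)) = 1"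
      by (metis cis.simps(1) one_complex.simps(1))
    then obtain n :: int where "real j * (2 * pi / N) = of_int n * 2 * pi"
      using cos_one_2pi_int by blast
    then have "real j = of_int n * real N"
      using assms by (simp add: field_simps)
    then have "int j = n * int N"
      by (metis of_int_eq_iff of_int_mult of_int_of_nat_eq)
    with assms False show False
      by (metis dvd_triv_right int_dvd_int_iff nat_dvd_not_less neq0_conv)
  qed
  then have "(\<Sum>k<N. (?w ^ j) ^ k) = ((?w ^ j) ^ N - 1) / (?w ^ j - 1)"
    by (rule geometric_sum)
  also have "(?w ^ j) ^ N = 1"
    using \<open>?w ^ N = 1\<close> by (metis power_mult mult.commute power_one)
  finally show ?thesis
    using False by (simp add: power_mult[symmetric] mult.commute)
qed simp

lemma geometric_sum_left: "(1 - x) * (\<Sum>j<N. x ^ j) = 1 - (x :: 'a :: ring_1) ^ N"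
proof (induction N)
  case (Suc N)
  have "(1 - x) * (\<Sum>j<Suc N. x ^ j) = (1 - x ^ N) + (1 - x) * x ^ N"
    by (simp add: distrib_left Suc)
  then show ?case
    by (simp add: left_diff_distrib)
qed simp

text \<open>
  With \<open>w\<close> running through the \<open>N\<close>-th roots of unity, \<open>1 - y ^ N = (1 - w y) (\<Sum>j<N. (w y) ^ j)\<close>, so the
  inverse of \<open>1 - w y\<close> times \<open>1 - y ^ N\<close> is that geometric sum; on averaging over \<open>w\<close> only the term
  \<open>j = 0\<close> survives. Averages of the resolvent over a circle thereby control all powers of \<open>y\<close>.
\<close>

lemma resolvent_average:
  fixes y :: "'a :: complex_banach_algebra"
  assumes N: "0 < N"
    and R: "\<And>k. k < N \<Longrightarrow> inverse_pair (1 - cis (2 * pi / N) ^ k *\<^sub>C y) (R k)"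
  shows "inverse_pair (1 - y ^ N) ((1 / N) *\<^sub>R (\<Sum>k<N. R k))"
proof -
  define w where "w = cis (2 * pi / N)"
  have wN: "w ^ N = 1"
    using N by (simp add: w_def cis_root_of_unity)
  define S where "S k = (\<Sum>j<N. (w ^ k *\<^sub>C y) ^ j)" for k
  have S1: "(1 - w ^ k *\<^sub>C y) * S k = 1 - y ^ N" for k
  proof -
    have "(1 - w ^ k *\<^sub>C y) * S k = 1 - (w ^ k *\<^sub>C y) ^ N"
      unfolding S_def by (rule geometric_sum_left)
    also have "(w ^ k *\<^sub>C y) ^ N = (w ^ N) ^ k *\<^sub>C y ^ N"
      by (simp add: power_scaleC power_mult[symmetric] mult.commute)
    finally show ?thesis
      by (simp add: wN)
  qed
  have S2: "S k * (1 - w ^ k *\<^sub>C y) = 1 - y ^ N" for k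
  proof -
    have "S k * (w ^ k *\<^sub>C y) = (w ^ k *\<^sub>C y) * S k"
      unfolding S_def by (simp add: sum_distrib_left sum_distrib_right power_commutes)
    with S1[of k] show ?thesis
      by (simp add: algebra_simps)
  qed
  have a: "R k * (1 - y ^ N) = S k" "(1 - y ^ N) * R k = S k" if "k < N" for k
    using R[OF that] unfolding inverse_pair_def w_def[symmetric]
    by (metis S1 mult.assoc mult_1_left, metis S2 mult.assoc mult_1_right)
  have "(\<Sum>k<N. S k) = (\<Sum>j<N. (\<Sum>k<N. (w ^ k) ^ j) *\<^sub>C y ^ j)"
    unfolding S_def by (subst sum.swap) (simp add: power_scaleC scaleC_sum_left)
  also have "\<dots> = (\<Sum>j<N. if j = 0 then of_nat N *\<^sub>C 1 else 0)"
    using N sum_powers_root_of_unity by (intro sum.cong) (auto simp: w_def)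
  also have "\<dots> = real N *\<^sub>R 1"
    using N by (simp add: scaleR_scaleC)
  finally have sum: "(\<Sum>k<N. S k) = real N *\<^sub>R 1" .
  show ?thesis
    unfolding inverse_pair_def using N
    by (simp add: sum_distrib_left sum_distrib_right a sum)
qed

lemma bounded_powers_mono:
  fixes x :: "'a :: real_normed_algebra_1"
  assumes "\<And>N. norm ((s *\<^sub>R x) ^ N) \<le> C" and "0 \<le> r" "r < s"
  shows "(\<lambda>N. (r *\<^sub>R x) ^ N) \<longlonglongrightarrow> 0"
proof -
  have "(\<lambda>N. (r / s) ^ N * C) \<longlonglongrightarrow> 0 * C"
    using assms by (intro tendsto_intros LIMSEQ_power_zero) auto
  then have lim: "(\<lambda>N. (r / s) ^ N * C) \<longlonglongrightarrow> 0"
    by simp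
  have "norm ((r *\<^sub>R x) ^ N) \<le> (r / s) ^ N * C" for N
  proof -
    have "(r *\<^sub>R x) ^ N = (r / s) ^ N *\<^sub>R (s *\<^sub>R x) ^ N"
      using assms by (simp add: power_divide scaleR_power)
    moreover have "norm ((r / s) ^ N *\<^sub>R (s *\<^sub>R x) ^ N) \<le> (r / s) ^ N * C"
      unfolding norm_scaleR using assms by (auto intro!: mult_left_mono)
    ultimately show ?thesis
      by (simp only:)
  qed
  then show ?thesis
    by (intro Lim_null_comparison[OF always_eventually lim] allI)
qed

text \<open>
  The upper bound in the spectral radius formula, by Rickart's elementary argument in place of
  Cauchy's integral. The resolvent \<open>R\<close> is uniformly continuous on the closed unit disc, so its averages
  \<open>f N r\<close> over the \<open>N\<close>-th roots of unity on the circle of radius \<open>r\<close> are equicontinuous in \<open>r\<close>,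
  uniformly in \<open>N\<close>. If the powers of \<open>r x\<close> are bounded, they tend to 0 at every smaller radius, so
  \<open>f N\<close> is close to 1 there for large \<open>N\<close>; by equicontinuity it is still close to 1 at a radius \<open>s\<close> larger than \<open>r\<close> by
  a fixed step, and inverting bounds the powers of \<open>s x\<close>. Finitely many steps lead from radius 0 to 1.
\<close>

theorem bounded_powers:
  fixes x :: "'a :: complex_banach_algebra"
  assumes inv: "\<And>z. cmod z \<le> 1 \<Longrightarrow> \<exists>b. inverse_pair (1 - z *\<^sub>C x) b"
  shows "\<exists>C. \<forall>N. norm (x ^ N) \<le> C"
proof -
  from inv obtain R where R: "inverse_pair (1 - z *\<^sub>C x) (R z)" if "cmod z \<le> 1" for z
    by metis
  have "continuous_on (cball 0 1) R"
    unfolding continuous_on_def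
  proof
    fix z :: complex assume z: "z \<in> cball 0 1"
    show "(R \<longlongrightarrow> R z) (at z within cball 0 1)"
    proof (rule inverse_pair_tendsto)
      show "((\<lambda>u. 1 - u *\<^sub>C x) \<longlongrightarrow> 1 - z *\<^sub>C x) (at z within cball 0 1)"
        by (intro tendsto_intros bounded_bilinear.tendsto[OF bounded_bilinear_scaleC])
      show "\<forall>\<^sub>F u in at z within cball 0 1. inverse_pair (1 - u *\<^sub>C x) (R u)"
        unfolding eventually_at_filter using R by simp
    qed (use R z in auto)
  qed
  then have "uniformly_continuous_on (cball 0 1) R"
    by (rule compact_uniformly_continuous) simp
  then obtain d where "0 < d"
    and d: "\<And>u v. cmod u \<le> 1 \<Longrightarrow> cmod v \<le> 1 \<Longrightarrow> dist u v < d \<Longrightarrow> dist (R u) (R v) < 1 / 4"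
    unfolding uniformly_continuous_on_def 
    by (auto dest!: spec[of _ "1/4"] simp: dist_commute)
  define f where "f N r = (1 / N) *\<^sub>R (\<Sum>k<N. R (cis (2 * pi / N) ^ k * complex_of_real r))"
    for N :: nat and r :: real
  have f: "inverse_pair (1 - (r *\<^sub>R x) ^ N) (f N r)" if "0 < N" "0 \<le> r" "r \<le> 1" for N r
    unfolding f_def using that
    by (intro resolvent_average that)
       (auto simp: scaleR_scaleC scaleC_scaleC norm_mult norm_power intro!: R)
  have fd: "norm (f N r - f N s) \<le> 1 / 4"
    if "0 < N" "0 \<le> r" "r \<le> 1" "0 \<le> s" "s \<le> 1" "\<bar>r - s\<bar> < d" for N r s
  proof -
    let ?w = "\<lambda>k. cis (2 * pi / N) ^ k"
    have "f N r - f N s = (1 / N) *\<^sub>R (\<Sum>k<N. R (?w k * r) - R (?w k * s))"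
      by (simp add: f_def sum_subtractf scaleR_diff_right)
    also have "norm \<dots> \<le> (1 / N) * (\<Sum>k<N. norm (R (?w k * r) - R (?w k * s)))"
      using that by (auto intro!: divide_right_mono norm_sum)
    also have "\<dots> \<le> (1 / N) * (\<Sum>k<N. 1 / 4)"
    proof (intro mult_left_mono sum_mono)
      fix k
      have "dist (?w k * r) (?w k * s) = \<bar>r - s\<bar>"
        unfolding dist_norm right_diff_distrib[symmetric] norm_mult of_real_diff[symmetric] norm_of_real
        by (simp add: norm_power)
      then show "norm (R (?w k * r) - R (?w k * s)) \<le> 1 / 4"
        using that d[of "?w k * r" "?w k * s"]
        by (simp add: norm_mult norm_power dist_norm)
    qed auto
    finally show ?thesis
      using that by simp
  qed
  define Q where "Q s \<longleftrightarrow> (\<exists>C. \<forall>N. norm ((s *\<^sub>R x) ^ N) \<le> C)" for s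
  have step: "Q s" if "Q r" "0 \<le> r" "r \<le> s" "s \<le> 1" "s \<le> r + d / 3" for r s
  proof -
    \<comment> \<open>Retreating from \<open>r\<close> by one step makes the powers null; \<open>r'\<close> and \<open>s\<close> remain closer than \<open>d\<close>.\<close>
    define r' where "r' = max 0 (r - d / 3)"
    have r': "0 \<le> r'" "r' \<le> r" "\<bar>s - r'\<bar> < d"
      using that \<open>0 < d\<close> by (auto simp: r'_def)
    have "(\<lambda>N. (r' *\<^sub>R x) ^ N) \<longlonglongrightarrow> 0"
    proof (cases "r = 0")
      case True
      then have "r' = 0" using r' by simp
      then have "\<forall>\<^sub>F N in sequentially. (r' *\<^sub>R x) ^ N = 0"
        by (intro eventually_sequentiallyI[of 1]) (auto simp: power_0_left)
      then show ?thesis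
        by (rule tendsto_eventually)
    next
      case False
      then have "r' < r"
        using that \<open>0 < d\<close> by (auto simp: r'_def)
      then show ?thesis
        using \<open>Q r\<close> r' bounded_powers_mono unfolding Q_def by blast
    qed
    then have "(\<lambda>N. norm ((r' *\<^sub>R x) ^ N)) \<longlonglongrightarrow> 0"
      by (rule tendsto_norm_zero)
    then have "\<forall>\<^sub>F N in sequentially. norm ((r' *\<^sub>R x) ^ N) < 1 / 5"
      by (rule order_tendstoD) simp
    then have "\<forall>\<^sub>F N in sequentially. norm ((s *\<^sub>R x) ^ N) \<le> 3"
      using eventually_gt_at_top[of 0]
    proof eventually_elim
      case (elim N)
      let ?y = "(r' *\<^sub>R x) ^ N" and ?g = "1 - (s *\<^sub>R x) ^ N"
      have "f N r' * (1 - ?y) = 1"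
        using f[of N r'] elim r' that unfolding inverse_pair_def by auto
      then have "f N r' - 1 = f N r' * ?y"
        unfolding right_diff_distrib by (simp only: mult_1_right diff_eq_eq add.commute)
      then have 1: "norm (f N r' - 1) \<le> norm (f N r') * norm ?y"
        by (simp only: norm_mult_ineq)
      also have "\<dots> \<le> norm (f N r') * (1 / 5)"
        using elim by (intro mult_left_mono) auto
      finally have "norm (f N r' - 1) \<le> 1 / 4"
        using norm_triangle_ineq2[of "f N r'" 1] by simp
      moreover have "norm (f N s - f N r') \<le> 1 / 4"
        using fd elim r' that by auto
      ultimately have 2: "norm (f N s - 1) \<le> 1 / 2"
        using norm_triangle_ineq[of "f N s - f N r'" "f N r' - 1"] by (simp del: scaleR_power)
      have "f N s * ?g = 1"
        using f[of N s] elim r' that unfolding inverse_pair_def by auto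
      then have "?g = 1 - (f N s - 1) * ?g"
        by (simp only: left_diff_distrib mult_1_left) simp
      then have "norm ?g \<le> 1 + norm ((f N s - 1) * ?g)"
        by (metis norm_one norm_triangle_ineq4)
      also have "norm ((f N s - 1) * ?g) \<le> 1 / 2 * norm ?g"
        using 2 by (meson mult_right_mono norm_ge_zero norm_mult_ineq order_trans)
      finally have "norm ?g \<le> 2"
        by linarith
      then show ?case
        using norm_triangle_ineq4[of 1 ?g] by (simp del: scaleR_power)
    qed
    then obtain n where n: "\<And>N. n \<le> N \<Longrightarrow> norm ((s *\<^sub>R x) ^ N) \<le> 3"
      unfolding eventually_sequentially by blast
    have "norm ((s *\<^sub>R x) ^ N) \<le> max 3 (Max ((\<lambda>N. norm ((s *\<^sub>R x) ^ N)) ` {..n}))" for N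
      using n[of N] by (cases "n \<le> N") (auto simp: le_max_iff_disj intro!: Max_ge)
    then show ?thesis
      unfolding Q_def by blast
  qed
  have "Q (min 1 (real k * (d / 3)))" for k
  proof (induction k)
    case 0
    show ?case
      unfolding Q_def by (intro exI[of _ 1]) (simp add: power_0_left)
  next
    case (Suc k)
    show ?case
      using \<open>0 < d\<close> by (intro step[OF Suc]) (auto simp: algebra_simps min_def)
  qed
  moreover obtain k where "1 \<le> real k * (d / 3)"
    using \<open>0 < d\<close> reals_Archimedean3[of "d/3"] by (meson divide_pos_pos less_imp_le zero_less_numeral)
  ultimately have "Q 1"
    by (metis min.absorb1)
  then show ?thesis
    by (simp add: Q_def)
qed

section \<open>Spectrum and decay of the exponential\<close>

text \<open>
  For large \<open>n\<close> the part of the half plane \<open>Re l < -d\<close> inside a disc that contains the spectrum of \<open>G\<close>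
  lies in the disc of centre \<open>-n\<close> and radius \<open>n \<rho>\<close>, for some \<open>\<rho> < 1\<close>. So the powers of \<open>W = 1 + G / n\<close>
  are bounded by \<open>C \<rho> ^ k\<close>, and \<open>exp (t G) = exp (- t n) exp (t n W)\<close> can be estimated term by term in the
  exponential series of \<open>W\<close>, which gives \<open>C exp (- n (1 - \<rho>) t)\<close>.
\<close>

theorem exp_decay:
  fixes G :: "'a :: complex_banach_algebra"
  assumes d: "0 < d" and inv: "\<And>l. - d \<le> Re l \<Longrightarrow> \<exists>b. inverse_pair (l *\<^sub>C 1 - G) b"
  shows "\<exists>M c. 0 < c \<and> (\<forall>t\<ge>0. norm (exp (t *\<^sub>R G)) \<le> M * exp (- c * t))"
proof -
  define K where "K = norm G + 1"
  \<comment> \<open>This choice makes \<open>d / n < 1\<close> and \<open>2 K\<^sup>2 \<le> n d\<close>; the latter confines the exceptional \<open>l\<close> below to \<open>cmod l \<ge> K\<close>.\<close>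
  define n where "n = 2 * K\<^sup>2 / d + 2 * d"
  define \<rho> where "\<rho> = sqrt (1 - d / n)"
  have "0 < K"
    by (simp add: K_def add_nonneg_pos)
  then have n: "0 < n" "d / n < 1" "2 * K\<^sup>2 \<le> n * d"
    using d by (auto simp: n_def field_simps add_pos_pos)
  have \<rho>: "0 < \<rho>" "\<rho> < 1" "\<rho>\<^sup>2 = 1 - d / n"
    using n d by (auto simp: \<rho>_def)
  define W where "W = 1 + (1 / n) *\<^sub>R G"
  have far: "\<exists>b. inverse_pair (l *\<^sub>C 1 - G) b" if "norm G < cmod l" for l
  proof -
    have "l \<noteq> 0"
      using that by (auto simp: not_less)
    have "norm (inverse l *\<^sub>C G) < 1"
      using that \<open>l \<noteq> 0\<close> by (simp add: norm_scaleC norm_inverse norm_divide field_simps)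
    then obtain b where "inverse_pair (1 - inverse l *\<^sub>C G) b"
      using neumann by blast
    then have "inverse_pair (l *\<^sub>C (1 - inverse l *\<^sub>C G)) (inverse l *\<^sub>C b)"
      using \<open>l \<noteq> 0\<close> by (rule inverse_pair_scaleC)
    then show ?thesis
      using \<open>l \<noteq> 0\<close> by (auto simp: scaleC_diff_right scaleC_scaleC)
  qed
  have "\<exists>b. inverse_pair (1 - z *\<^sub>C (1 / \<rho>) *\<^sub>R W) b" if z: "cmod z \<le> 1" for z
  proof (cases "z = 0")
    case True
    then show ?thesis
      by (auto simp: inverse_pair_def)
  next
    case False
    define l where "l = n * (\<rho> / z - 1)"
    \<comment> \<open>\<open>l\<close> lies outside the disc of centre \<open>-n\<close> and radius \<open>n \<rho>\<close>: if \<open>Re l < -d\<close>, this forces \<open>cmod l \<ge> K\<close>.\<close>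
    have "\<exists>b. inverse_pair (l *\<^sub>C 1 - G) b"
    proof (cases "- d \<le> Re l")
      case False
      have "\<rho> \<le> cmod (\<rho> / z)"
        using \<rho> z \<open>z \<noteq> 0\<close> by (simp add: norm_divide field_simps)
      then have "n * \<rho> \<le> cmod (n * (\<rho> / z))"
        using n by (simp only: norm_mult) simp
      also have "n * (\<rho> / z) = n + l"
        by (simp add: l_def algebra_simps)
      finally have "(n * \<rho>)\<^sup>2 \<le> (cmod (n + l))\<^sup>2"
        using n \<rho> by (intro power_mono) auto
      also have "(n * \<rho>)\<^sup>2 = n\<^sup>2 * (1 - d / n)"
        by (simp only: power_mult_distrib \<rho>)
      also have "\<dots> = n\<^sup>2 - n * d"
        using n by (simp add: field_simps power2_eq_square)
      also have "(cmod (n + l))\<^sup>2 = n\<^sup>2 + 2 * n * Re l + (cmod l)\<^sup>2"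
        by (simp only: cmod_power2) (simp add: power2_eq_square algebra_simps)
      finally have "- (n * d) \<le> 2 * (n * Re l) + (cmod l)\<^sup>2"
        by simp
      moreover have "n * Re l \<le> n * (- d)"
        using False n by (intro mult_left_mono) auto
      ultimately have "K\<^sup>2 \<le> (cmod l)\<^sup>2"
        using n zero_le_power2[of K] by linarith
      then have "K \<le> cmod l"
        by (rule power2_le_imp_le) simp
      then show ?thesis
        by (intro far) (simp add: K_def)
    qed (rule inv)
    then obtain b where "inverse_pair (l *\<^sub>C 1 - G) b" ..
    then have "inverse_pair ((z / (\<rho> * n)) *\<^sub>C (l *\<^sub>C 1 - G)) (inverse (z / (\<rho> * n)) *\<^sub>C b)"
      using False n \<rho> by (intro inverse_pair_scaleC) auto
    moreover have "(z / (\<rho> * n)) *\<^sub>C (l *\<^sub>C 1 - G) = 1 - z *\<^sub>C (1 / \<rho>) *\<^sub>R W"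
    proof -
      have "z / (\<rho> * n) * l = 1 - z / \<rho>"
        using False n \<rho> by (simp add: l_def field_simps)
      then show ?thesis
        by (simp add: W_def scaleR_scaleC scaleC_diff_right scaleC_diff_left scaleC_scaleC
            scaleC_add_right)
    qed
    ultimately show ?thesis
      by auto
  qed
  then obtain C where C: "\<And>k. norm (((1 / \<rho>) *\<^sub>R W) ^ k) \<le> C"
    using bounded_powers by blast
  have W: "norm (W ^ k) \<le> C * \<rho> ^ k" for k
    using C[of k] \<rho> by (simp add: field_simps)
  have expW: "norm (exp (s *\<^sub>R W)) \<le> C * exp (s * \<rho>)" if "0 \<le> s" for s
  proof -
    have "norm (exp (s *\<^sub>R W)) \<le> (\<Sum>k. C * ((s * \<rho>) ^ k /\<^sub>R fact k))"
      unfolding exp_def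
    proof (rule norm_suminf_le)
      fix k
      have "norm ((s *\<^sub>R W) ^ k /\<^sub>R fact k) = s ^ k * norm (W ^ k) / fact k"
        using that by (simp add: field_simps)
      also have "\<dots> \<le> s ^ k * (C * \<rho> ^ k) / fact k"
        using that W by (intro divide_right_mono mult_left_mono) auto
      finally show "norm ((s *\<^sub>R W) ^ k /\<^sub>R fact k) \<le> C * ((s * \<rho>) ^ k /\<^sub>R fact k)"
        by (simp add: field_simps)
    qed (intro summable_mult summable_exp_generic)
    also have "\<dots> = C * exp (s * \<rho>)"
      unfolding exp_def by (intro suminf_mult summable_exp_generic)
    finally show ?thesis .
  qed
  have "norm (exp (t *\<^sub>R G)) \<le> C * exp (- (n * (1 - \<rho>)) * t)" if "0 \<le> t" for t
  proof -
    have "t *\<^sub>R G = (t * n) *\<^sub>R W + of_real (- (t * n))"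
      using n by (simp add: W_def of_real_def scaleR_add_right)
    then have "exp (t *\<^sub>R G) = exp ((t * n) *\<^sub>R W) * exp (of_real (- (t * n)))"
      by (simp only:) (rule exp_add_commuting, simp add: of_real_def)
    also have "\<dots> = exp (- (t * n)) *\<^sub>R exp ((t * n) *\<^sub>R W)"
      by (simp only: exp_of_real) (simp add: of_real_def)
    also have "norm \<dots> \<le> exp (- (t * n)) * (C * exp (t * n * \<rho>))"
      using expW[of "t * n"] that n by simp
    also have "\<dots> = C * exp (- (n * (1 - \<rho>)) * t)"
      by (simp add: exp_add[symmetric] algebra_simps)
    finally show ?thesis .
  qed
  then show ?thesis
    using n \<rho> by (intro exI[of _ C] exI[of _ "n * (1 - \<rho>)"]) auto
qed

lemma exp_scaleC_one: "exp (z *\<^sub>C (1 :: 'a :: complex_banach_algebra)) = exp z *\<^sub>C 1"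
proof -
  interpret bounded_linear "\<lambda>z. z *\<^sub>C (1 :: 'a)"
    by (rule bounded_bilinear.bounded_linear_left[OF bounded_bilinear_scaleC])
  have "(\<lambda>k. (z ^ k /\<^sub>R fact k) *\<^sub>C (1 :: 'a)) sums (exp z *\<^sub>C 1)"
    by (rule sums) (rule exp_converges)
  moreover have "(\<lambda>k. (z ^ k /\<^sub>R fact k) *\<^sub>C (1 :: 'a)) = (\<lambda>k. (z *\<^sub>C 1) ^ k /\<^sub>R fact k)"
    by (simp add: power_scaleC scaleR)
  ultimately have "(\<lambda>k. (z *\<^sub>C 1) ^ k /\<^sub>R fact k) sums (exp z *\<^sub>C (1 :: 'a))"
    by simp
  then show ?thesis
    using exp_converges sums_unique2 by blast
qed

lemma exp_minus_one_factor:
  fixes x :: "'a :: {real_normed_algebra_1, banach}"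
  shows "\<exists>q. exp x - 1 = x * q \<and> exp x - 1 = q * x"
proof -
  define f where "f k = x ^ k /\<^sub>R fact (Suc k)" for k
  have "summable f"
  proof (rule summable_comparison_test)
    have "norm (f k) \<le> norm (x ^ k /\<^sub>R fact k)" for k
      unfolding f_def norm_scaleR
      by (intro mult_right_mono) (auto intro!: le_imp_inverse_le fact_mono simp del: fact_Suc)
    then show "\<exists>N. \<forall>k\<ge>N. norm (f k) \<le> norm (x ^ k /\<^sub>R fact k)"
      by blast
  qed (rule summable_norm_exp)
  have exp: "(\<lambda>k. x ^ Suc k /\<^sub>R fact (Suc k)) sums (exp x - 1)"
    using sums_Suc_iff[of "\<lambda>k. x ^ k /\<^sub>R fact k" "exp x - 1"] exp_converges[of x]
    by (simp del: fact_Suc power_Suc)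
  have "(\<lambda>k. x * f k) sums (x * suminf f)"
    by (intro sums_mult summable_sums \<open>summable f\<close>)
  then have "exp x - 1 = x * suminf f"
    using exp by (intro sums_unique2[OF exp]) (simp add: f_def)
  moreover have "(\<lambda>k. f k * x) sums (suminf f * x)"
    by (intro sums_mult2 summable_sums \<open>summable f\<close>)
  then have "exp x - 1 = suminf f * x"
    using exp by (intro sums_unique2[OF exp]) (simp add: f_def power_commutes)
  ultimately show ?thesis
    by blast
qed

text \<open>
  \<open>exp x - 1\<close> is invertible by the Neumann series, and \<open>x\<close> is a factor of it on either side.
\<close>

lemma inverse_pair_of_exp:
  fixes x :: "'a :: {real_normed_algebra_1, banach}"
  assumes "norm (exp x) < 1"
  shows "\<exists>b. inverse_pair x b"
proof -
  obtain b where b: "inverse_pair (1 - exp x) b"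
    using neumann assms by blast
  obtain q where q: "exp x - 1 = x * q" "exp x - 1 = q * x"
    using exp_minus_one_factor by blast
  have "1 - exp x = x * (- q)" "1 - exp x = (- q) * x"
    using q by (metis minus_diff_eq mult_minus_right, metis minus_diff_eq mult_minus_left)
  then have r: "x * ((- q) * b) = 1" and l: "(b * (- q)) * x = 1"
    using b unfolding inverse_pair_def by (metis mult.assoc, metis mult.assoc)
  then have "b * (- q) = (- q) * b"
    by (metis mult.assoc mult_1_left mult_1_right)
  with l r show ?thesis
    unfolding inverse_pair_def by metis
qed

text \<open>
  For large \<open>t\<close> the element \<open>x = t (T - l)\<close> satisfies \<open>norm (exp x) < 1\<close>, and so it is invertible. This
  replaces the Laplace transform of the semigroup.
\<close>

theorem resolvent_of_exp_decay:
  fixes T :: "'a :: complex_banach_algebra"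
  assumes decay: "\<And>t. 0 \<le> t \<Longrightarrow> norm (exp (t *\<^sub>R T)) \<le> M * exp (- c * t)"
    and l: "- c < Re l"
  shows "\<exists>b. inverse_pair (l *\<^sub>C 1 - T) b"
proof -
  \<comment> \<open>At this time the decay factor is \<open>exp (- (\<bar>M\<bar> + 1))\<close>, which outweighs \<open>M\<close>.\<close>
  define t where "t = (\<bar>M\<bar> + 1) / (c + Re l)"
  have t: "0 < t"
    using l by (simp add: t_def)
  define x where "x = t *\<^sub>R T + (- (t * l)) *\<^sub>C 1"
  have "exp x = exp (t *\<^sub>R T) * exp ((- (t * l)) *\<^sub>C 1)"
    unfolding x_def by (rule exp_add_commuting) (simp add: mult_scaleC_left mult_scaleC_right
        scaleR_scaleC scaleC_scaleC mult.commute)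
  also have "\<dots> = exp (- (t * l)) *\<^sub>C exp (t *\<^sub>R T)"
    unfolding exp_scaleC_one by (simp add: mult_scaleC_right)
  also have "norm \<dots> = exp (- (t * Re l)) * norm (exp (t *\<^sub>R T))"
    by (simp add: norm_scaleC)
  also have "\<dots> \<le> exp (- (t * Re l)) * (M * exp (- c * t))"
    using decay t by (intro mult_left_mono) auto
  also have "\<dots> = M * exp (- (t * (c + Re l)))"
    by (simp add: exp_add[symmetric] algebra_simps)
  also have "t * (c + Re l) = \<bar>M\<bar> + 1"
    using l by (simp add: t_def)
  also have "M * exp (- (\<bar>M\<bar> + 1)) < 1"
  proof -
    have "M < exp (\<bar>M\<bar> + 1)"
      using exp_ge_add_one_self[of "\<bar>M\<bar> + 1"] by linarith
    then have "M * exp (- (\<bar>M\<bar> + 1)) < exp (\<bar>M\<bar> + 1) * exp (- (\<bar>M\<bar> + 1))"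
      by (intro mult_strict_right_mono) auto
    then show ?thesis
      by (simp add: exp_add[symmetric])
  qed
  finally obtain b where "inverse_pair x b"
    using inverse_pair_of_exp by blast
  then have "inverse_pair (complex_of_real (- 1 / t) *\<^sub>C x) (inverse (complex_of_real (- 1 / t)) *\<^sub>C b)"
    using t by (intro inverse_pair_scaleC) auto
  moreover have "complex_of_real (- 1 / t) *\<^sub>C x = l *\<^sub>C 1 - T"
    using t by (simp add: x_def scaleR_scaleC scaleC_add_right scaleC_diff_right scaleC_scaleC
        scaleC_minus_left)
  ultimately show ?thesis
    by auto
qed

section \<open>The Banach algebra of bounded operators\<close>

text \<open>
  Bounded complex-linear operators, each paired with an independent complex scalar: the product of
  the algebra of operators with the complex numbers. The second factor ensures that 0 and 1 differ
  and that 1 has norm 1 even if the underlying space is zero, as the unital Banach algebra class requires.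
\<close>

typedef (overloaded) 'a op_alg =
  "{p :: ('a::complex_normed_vector \<Rightarrow>\<^sub>L 'a) \<times> complex.
      \<forall>z x. blinfun_apply (fst p) (z *\<^sub>C x) = z *\<^sub>C blinfun_apply (fst p) x}"
  by (intro exI[of _ 0]) simp

setup_lifting type_definition_op_alg

definition op_part :: "'a::complex_normed_vector op_alg \<Rightarrow> 'a \<Rightarrow>\<^sub>L 'a"
  where "op_part X = fst (Rep_op_alg X)"

definition scalar_part :: "'a::complex_normed_vector op_alg \<Rightarrow> complex"
  where "scalar_part X = snd (Rep_op_alg X)"

lemma op_alg_eqI:
  "op_part X = op_part Y \<Longrightarrow> scalar_part X = scalar_part Y \<Longrightarrow> X = Y"
  by (simp add: Rep_op_alg_inject[symmetric] op_part_def scalar_part_def prod_eq_iff)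

lemma op_part_scaleC: "blinfun_apply (op_part X) (z *\<^sub>C x) = z *\<^sub>C blinfun_apply (op_part X) x"
  using Rep_op_alg[of X] by (simp add: op_part_def)

instantiation op_alg :: (complex_normed_vector) complex_normed_vector
begin

lift_definition plus_op_alg :: "'a op_alg \<Rightarrow> 'a op_alg \<Rightarrow> 'a op_alg" is "(+)"
  by (simp add: plus_blinfun.rep_eq scaleC_add_right)

lift_definition minus_op_alg :: "'a op_alg \<Rightarrow> 'a op_alg \<Rightarrow> 'a op_alg" is "(-)"
  by (simp add: minus_blinfun.rep_eq scaleC_diff_right)

lift_definition uminus_op_alg :: "'a op_alg \<Rightarrow> 'a op_alg" is uminus
  by (simp add: uminus_blinfun.rep_eq scaleC_minus_right)

lift_definition zero_op_alg :: "'a op_alg" is 0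
  by simp

lift_definition scaleR_op_alg :: "real \<Rightarrow> 'a op_alg \<Rightarrow> 'a op_alg" is scaleR
  by (simp add: scaleR_blinfun.rep_eq scaleR_scaleC scaleC_scaleC mult.commute)

lift_definition scaleC_op_alg :: "complex \<Rightarrow> 'a op_alg \<Rightarrow> 'a op_alg"
  is "\<lambda>c p. (Blinfun (scaleC c) o\<^sub>L fst p, c * snd p)"
  by (simp add: bounded_linear_Blinfun_apply scaleC_scaleC mult.commute
      bounded_bilinear.bounded_linear_right[OF bounded_bilinear_scaleC])

lift_definition norm_op_alg :: "'a op_alg \<Rightarrow> real" is "\<lambda>p. max (norm (fst p)) (norm (snd p))" .

definition dist_op_alg :: "'a op_alg \<Rightarrow> 'a op_alg \<Rightarrow> real"
  where "dist_op_alg X Y = norm (X - Y)"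

definition sgn_op_alg :: "'a op_alg \<Rightarrow> 'a op_alg"
  where "sgn_op_alg X = scaleR (inverse (norm X)) X"

definition uniformity_op_alg :: "('a op_alg \<times> 'a op_alg) filter"
  where "uniformity_op_alg = (INF e\<in>{0 <..}. principal {(x, y). dist x y < e})"

definition open_op_alg :: "'a op_alg set \<Rightarrow> bool"
  where "open_op_alg S = (\<forall>x\<in>S. \<forall>\<^sub>F (x', y) in uniformity. x' = x \<longrightarrow> y \<in> S)"

lemma op_alg_simps:
  fixes X Y :: "'a op_alg"
  shows "op_part (X + Y) = op_part X + op_part Y" "scalar_part (X + Y) = scalar_part X + scalar_part Y"
    and "op_part (X - Y) = op_part X - op_part Y" "scalar_part (X - Y) = scalar_part X - scalar_part Y"
    and "op_part (- X) = - op_part X" "scalar_part (- X) = - scalar_part X"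
    and "op_part (0 :: 'a op_alg) = 0" "scalar_part (0 :: 'a op_alg) = 0"
    and "op_part (r *\<^sub>R X) = r *\<^sub>R op_part X" "scalar_part (r *\<^sub>R X) = r *\<^sub>R scalar_part X"
    and "blinfun_apply (op_part (c *\<^sub>C X)) x = c *\<^sub>C blinfun_apply (op_part X) x"
      "scalar_part (c *\<^sub>C X) = c * scalar_part X"
  by (simp_all add: op_part_def scalar_part_def plus_op_alg.rep_eq minus_op_alg.rep_eq
      uminus_op_alg.rep_eq zero_op_alg.rep_eq scaleR_op_alg.rep_eq scaleC_op_alg.rep_eq
      bounded_linear_Blinfun_apply bounded_bilinear.bounded_linear_right[OF bounded_bilinear_scaleC])

lemma norm_op_alg: "norm X = max (norm (op_part X)) (norm (scalar_part X))"
  by (simp add: op_part_def scalar_part_def norm_op_alg.rep_eq)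

instance
proof
  fix X Y Z :: "'a op_alg" and r s :: real and c d :: complex
  show "norm (X + Y) \<le> norm X + norm Y"
    using norm_triangle_ineq[of "op_part X" "op_part Y"]
      norm_triangle_ineq[of "scalar_part X" "scalar_part Y"]
    by (auto simp: norm_op_alg op_alg_simps)
  show "norm (r *\<^sub>R X) = \<bar>r\<bar> * norm X"
    by (simp add: norm_op_alg op_alg_simps max_mult_distrib_left)
  show "norm (c *\<^sub>C X) = cmod c * norm X"
  proof -
    have "norm (op_part (c *\<^sub>C X)) = cmod c * norm (op_part X)"
    proof (rule antisym)
      show "norm (op_part (c *\<^sub>C X)) \<le> cmod c * norm (op_part X)" for c and X :: "'a op_alg"
        by (rule norm_blinfun_bound)
           (auto simp: op_alg_simps norm_scaleC mult.assoc intro!: mult_left_mono norm_blinfun)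
      from this[of "inverse c" "c *\<^sub>C X"]
      show "cmod c * norm (op_part X) \<le> norm (op_part (c *\<^sub>C X))"
      proof (cases "c = 0")
        case False
        have "op_part (inverse c *\<^sub>C c *\<^sub>C X) = op_part X"
          using False by (intro blinfun_eqI) (simp add: op_alg_simps scaleC_scaleC)
        then show ?thesis
          using \<open>norm (op_part (inverse c *\<^sub>C c *\<^sub>C X)) \<le> _\<close> False
          by (simp add: norm_inverse norm_divide field_simps)
      qed simp
    qed
    then show ?thesis
      by (simp add: norm_op_alg op_alg_simps norm_mult max_mult_distrib_left)
  qed
  show "(norm X = 0) = (X = 0)"
    using op_alg_eqI[of X 0] by (auto simp: norm_op_alg op_alg_simps max_def split: if_splits)
qed (auto intro!: op_alg_eqI blinfun_eqI
       simp: op_alg_simps dist_op_alg_def sgn_op_alg_def uniformity_op_alg_def open_op_alg_def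
         blinfun.bilinear_simps scaleC_add_left scaleC_add_right scaleC_scaleC scaleC_of_real
         scaleR_add_left scaleR_add_right algebra_simps scaleR_conv_of_real)

end

instantiation op_alg :: ("{complex_normed_vector, banach}") complex_banach_algebra
begin

lift_definition one_op_alg :: "'a op_alg" is "(id_blinfun, 1)"
  by simp

lift_definition times_op_alg :: "'a op_alg \<Rightarrow> 'a op_alg \<Rightarrow> 'a op_alg"
  is "\<lambda>p q. (fst p o\<^sub>L fst q, snd p * snd q)"
  by simp

lemma op_alg_mult_simps:
  fixes X Y :: "'a op_alg"
  shows "blinfun_apply (op_part (X * Y)) x = blinfun_apply (op_part X) (blinfun_apply (op_part Y) x)"
    and "scalar_part (X * Y) = scalar_part X * scalar_part Y"
    and "blinfun_apply (op_part (1 :: 'a op_alg)) x = x" "scalar_part (1 :: 'a op_alg) = 1"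
  by (simp_all add: op_part_def scalar_part_def one_op_alg.rep_eq times_op_alg.rep_eq)

instance
proof
  fix X Y Z :: "'a op_alg" and r s :: real and c d :: complex
  show "norm (X * Y) \<le> norm X * norm Y"
  proof -
    have "op_part (X * Y) = op_part X o\<^sub>L op_part Y"
      by (rule blinfun_eqI) (simp add: op_alg_mult_simps)
    then have "norm (op_part (X * Y)) \<le> norm (op_part X) * norm (op_part Y)"
      by (simp add: norm_blinfun_compose)
    also have "\<dots> \<le> norm X * norm Y"
      by (intro mult_mono) (auto simp: norm_op_alg le_max_iff_disj)
    finally have "norm (op_part (X * Y)) \<le> norm X * norm Y" .
    moreover have "norm (scalar_part (X * Y)) \<le> norm X * norm Y"
      unfolding op_alg_mult_simps norm_mult
      by (intro mult_mono) (auto simp: norm_op_alg le_max_iff_disj)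
    ultimately show ?thesis
      by (simp add: norm_op_alg[of "X * Y"])
  qed
  show "norm (1 :: 'a op_alg) = 1"
  proof -
    have "norm (op_part (1 :: 'a op_alg)) \<le> 1"
      by (rule norm_blinfun_bound) (simp_all add: op_alg_mult_simps)
    then show ?thesis
      by (simp add: norm_op_alg op_alg_mult_simps)
  qed
  have "scalar_part (0 :: 'a op_alg) \<noteq> scalar_part 1"
    by (simp add: op_alg_simps op_alg_mult_simps)
  then show "(0 :: 'a op_alg) \<noteq> 1"
    by metis
next
  fix F :: "nat \<Rightarrow> 'a op_alg"
  assume F: "Cauchy F"
  have "Cauchy (\<lambda>n. op_part (F n))" "Cauchy (\<lambda>n. scalar_part (F n))"
    using F unfolding Cauchy_def dist_norm by (simp_all add: norm_op_alg op_alg_simps) blast+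
  then obtain T s where T: "(\<lambda>n. op_part (F n)) \<longlonglongrightarrow> T" and s: "(\<lambda>n. scalar_part (F n)) \<longlonglongrightarrow> s"
    by (meson Cauchy_convergent convergentD)
  have "T (z *\<^sub>C x) = z *\<^sub>C T x" for z x
  proof (rule LIMSEQ_unique)
    show "(\<lambda>n. op_part (F n) (z *\<^sub>C x)) \<longlonglongrightarrow> T (z *\<^sub>C x)"
      by (intro tendsto_intros T)
    show "(\<lambda>n. op_part (F n) (z *\<^sub>C x)) \<longlonglongrightarrow> z *\<^sub>C T x"
      unfolding op_part_scaleC
      by (intro bounded_bilinear.tendsto[OF bounded_bilinear_scaleC] tendsto_intros T)
  qed
  then have "Rep_op_alg (Abs_op_alg (T, s)) = (T, s)"
    by (intro Abs_op_alg_inverse) simp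
  then obtain X where X: "op_part X = T" "scalar_part X = s"
    unfolding op_part_def scalar_part_def by (metis fst_conv snd_conv)
  have "(\<lambda>n. max (norm (op_part (F n) - T)) (norm (scalar_part (F n) - s))) \<longlonglongrightarrow> max (norm (T - T)) (norm (s - s))"
    by (intro tendsto_intros T s)
  then have "(\<lambda>n. norm (F n - X)) \<longlonglongrightarrow> 0"
    by (simp add: norm_op_alg op_alg_simps X)
  then have "F \<longlonglongrightarrow> X"
    by (simp add: LIM_zero_iff tendsto_norm_zero_iff)
  then show "convergent F"
    by (rule convergentI)
qed (auto intro!: op_alg_eqI blinfun_eqI
       simp: op_alg_simps op_alg_mult_simps blinfun.bilinear_simps op_part_scaleC algebra_simps)

end

text \<open>
  The operator part is set to 0 outside the bounded complex-linear functions, where it carries no meaning.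
\<close>

lift_definition op_alg_of :: "('a::complex_normed_vector \<Rightarrow> 'a) \<Rightarrow> complex \<Rightarrow> 'a op_alg"
  is "\<lambda>T c. (if bounded_clinear T then Blinfun T else 0, c)"
  by (auto simp: bounded_clinear_def bounded_linear_Blinfun_apply)

lemma op_alg_of_simps:
  "bounded_clinear T \<Longrightarrow> blinfun_apply (op_part (op_alg_of T c)) = T"
  "scalar_part (op_alg_of T c) = c"
  by (simp_all add: op_part_def scalar_part_def op_alg_of.rep_eq bounded_clinear_def
      bounded_linear_Blinfun_apply)

lemma op_part_power:
  fixes X :: "'a::{complex_normed_vector, banach} op_alg"
  shows "blinfun_apply (op_part (X ^ k)) = blinfun_apply (op_part X) ^^ k"
  by (induction k) (auto simp: op_alg_mult_simps fun_eq_iff)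

lemma scalar_part_power:
  fixes X :: "'a::{complex_normed_vector, banach} op_alg"
  shows "scalar_part (X ^ k) = scalar_part X ^ k"
  by (induction k) (auto simp: op_alg_mult_simps)

lemma bounded_linear_op_part: "bounded_linear op_part"
  by (rule bounded_linear_intro[of _ 1]) (auto simp: op_alg_simps norm_op_alg)

lemma bounded_linear_scalar_part: "bounded_linear scalar_part"
  by (rule bounded_linear_intro[of _ 1]) (auto simp: op_alg_simps norm_op_alg)

lemma op_part_exp:
  fixes X :: "'a::{complex_normed_vector, banach} op_alg"
  shows "blinfun_apply (op_part (exp (t *\<^sub>R X))) = exp_op t (blinfun_apply (op_part X))"
proof
  fix x
  have "bounded_linear (\<lambda>Y :: 'a op_alg. blinfun_apply (op_part Y) x)"
    by (intro bounded_linear_compose[OF blinfun.bounded_linear_left bounded_linear_op_part])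
  then have "(\<lambda>k. blinfun_apply (op_part ((t *\<^sub>R X) ^ k /\<^sub>R fact k)) x) sums
      blinfun_apply (op_part (exp (t *\<^sub>R X))) x"
    using exp_converges by (rule bounded_linear.sums)
  also have "(\<lambda>k. blinfun_apply (op_part ((t *\<^sub>R X) ^ k /\<^sub>R fact k)) x) =
      (\<lambda>k. (t ^ k / fact k) *\<^sub>R (blinfun_apply (op_part X) ^^ k) x)"
    by (simp add: op_alg_simps blinfun.bilinear_simps op_part_power divide_inverse mult.commute)
  finally show "blinfun_apply (op_part (exp (t *\<^sub>R X))) x = exp_op t (blinfun_apply (op_part X)) x"
    by (simp add: exp_op_def sums_iff)
qed

lemma scalar_part_exp:
  fixes X :: "'a::{complex_normed_vector, banach} op_alg"
  shows "scalar_part (exp (t *\<^sub>R X)) = exp (t *\<^sub>R scalar_part X)"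
proof -
  have "(\<lambda>k. scalar_part ((t *\<^sub>R X) ^ k /\<^sub>R fact k)) sums scalar_part (exp (t *\<^sub>R X))"
    using bounded_linear_scalar_part exp_converges by (rule bounded_linear.sums)
  also have "(\<lambda>k. scalar_part ((t *\<^sub>R X) ^ k /\<^sub>R fact k)) = (\<lambda>k. (t *\<^sub>R scalar_part X) ^ k /\<^sub>R fact k)"
    by (simp add: op_alg_simps scalar_part_power)
  finally show ?thesis
    using exp_converges sums_unique2 by blast
qed

lemma inverse_pair_op_alg_of:
  fixes T :: "'a::{complex_normed_vector, banach} \<Rightarrow> 'a"
  assumes "bounded_clinear T" "bounded_clinear R" "l \<noteq> c"
    and "\<And>x. l *\<^sub>C R x - T (R x) = x" "\<And>x. R (l *\<^sub>C x - T x) = x"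
  shows "inverse_pair (l *\<^sub>C 1 - op_alg_of T c) (op_alg_of R (1 / (l - c)))"
  unfolding inverse_pair_def
proof (intro conjI op_alg_eqI blinfun_eqI)
qed (use assms in \<open>simp_all add: op_alg_simps op_alg_mult_simps op_alg_of_simps blinfun.bilinear_simps\<close>)

lemma op_part_inverse_pair:
  fixes T :: "'a::{complex_normed_vector, banach} \<Rightarrow> 'a"
  assumes "bounded_clinear T" "inverse_pair (l *\<^sub>C 1 - op_alg_of T c) X"
  shows "l *\<^sub>C op_part X x - T (op_part X x) = x" "op_part X (l *\<^sub>C x - T x) = x"
proof -
  have "op_part ((l *\<^sub>C 1 - op_alg_of T c) * X) x = op_part 1 x" 
    "op_part (X * (l *\<^sub>C 1 - op_alg_of T c)) x = op_part 1 x"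
    using assms(2) by (auto simp: inverse_pair_def)
  then show "l *\<^sub>C op_part X x - T (op_part X x) = x" "op_part X (l *\<^sub>C x - T x) = x"
    using assms(1) by (simp_all add: op_alg_simps op_alg_mult_simps op_alg_of_simps blinfun.bilinear_simps)
qed

section \<open>Exponential stability and the resolvent\<close>

lemma norm_max_le_norm: "norm_max (x :: 'x::real_normed_vector ^ 'n) \<le> norm x"
  by (auto simp: norm_max_def Finite_Cartesian_Product.norm_nth_le)

lemma norm_max_ge: "norm ((x :: 'x::real_normed_vector ^ 'n) $ i) \<le> norm_max x"
  by (auto simp: norm_max_def)

lemma norm_le_norm_max: "norm (x :: 'x::real_normed_vector ^ 'n) \<le> real CARD('n) * norm_max x"
proof -
  have "norm x \<le> (\<Sum>i\<in>UNIV. norm (x $ i))"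
    by (simp add: norm_vec_def L2_set_le_sum)
  also have "\<dots> \<le> (\<Sum>i::'n\<in>UNIV. norm_max x)"
    by (intro sum_mono norm_max_ge)
  finally show ?thesis
    by simp
qed

lemma norm_max_nonneg: "0 \<le> norm_max (x :: 'x::real_normed_vector ^ 'n)"
  using norm_max_ge norm_ge_zero order_trans by blast

lemma onorm_max_quotient_le:
  fixes T :: "('x::real_normed_vector ^ 'n) \<Rightarrow>\<^sub>L ('x ^ 'n)"
  shows "norm_max (T x) / norm_max x \<le> real CARD('n) * norm T"
proof (cases "norm_max x = 0")
  case False
  have "norm_max (T x) \<le> norm T * norm x"
    using norm_max_le_norm norm_blinfun order_trans by blast
  also have "\<dots> \<le> norm T * (real CARD('n) * norm_max x)"
    by (intro mult_left_mono norm_le_norm_max) simp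
  finally show ?thesis
    using False norm_max_nonneg[of x] by (simp add: field_simps)
qed simp

lemma onorm_max_le_norm:
  fixes T :: "('x::real_normed_vector ^ 'n) \<Rightarrow>\<^sub>L ('x ^ 'n)"
  shows "onorm_max (blinfun_apply T) \<le> real CARD('n) * norm T"
  unfolding onorm_max_def by (intro cSUP_least onorm_max_quotient_le) simp

lemma norm_le_onorm_max:
  fixes T :: "('x::real_normed_vector ^ 'n) \<Rightarrow>\<^sub>L ('x ^ 'n)"
  shows "norm T \<le> real CARD('n) * onorm_max (blinfun_apply T)"
proof -
  have q: "norm_max (T x) / norm_max x \<le> onorm_max (blinfun_apply T)" for x
    unfolding onorm_max_def
    by (intro cSUP_upper bdd_aboveI2[of _ _ "real CARD('n) * norm T"] onorm_max_quotient_le) simp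
  have nonneg: "0 \<le> onorm_max (blinfun_apply T)"
    using q[of 0] by (simp add: norm_max_def)
  show ?thesis
  proof (rule norm_blinfun_bound)
    fix x
    have "norm_max (T x) \<le> onorm_max (blinfun_apply T) * norm_max x"
    proof (cases "norm_max x = 0")
      case True
      then have "norm x \<le> 0"
        using norm_le_norm_max[of x] by simp
      then show ?thesis
        by (simp add: norm_max_def)
    next
      case False
      then show ?thesis
        using q[of x] norm_max_nonneg[of x] by (simp add: field_simps)
    qed
    also have "\<dots> \<le> onorm_max (blinfun_apply T) * norm x"
      by (intro mult_left_mono norm_max_le_norm nonneg)
    finally have "real CARD('n) * norm_max (T x) \<le> real CARD('n) * onorm_max (blinfun_apply T) * norm x"
      by (simp add: mult.assoc mult_left_mono)
    then show "norm (T x) \<le> real CARD('n) * onorm_max (blinfun_apply T) * norm x"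
      using norm_le_norm_max[of "T x"] by linarith
  qed (simp add: nonneg)
qed

text \<open>
  The adjoined scalar \<open>- d - 1\<close> keeps the spectrum of the pair to the left of \<open>- d\<close>.
\<close>

theorem exponentially_stableI:
  fixes T :: "'x::{complex_normed_vector, banach} ^ 'n \<Rightarrow> 'x ^ 'n"
  assumes T: "bounded_clinear T" and d: "0 < d"
    and inv: "\<And>l. - d \<le> Re l \<Longrightarrow> \<exists>R. bounded_clinear R \<and>
      (\<forall>x. l *\<^sub>C R x - T (R x) = x) \<and> (\<forall>x. R (l *\<^sub>C x - T x) = x)"
  shows "exponentially_stable T"
proof -
  let ?X = "op_alg_of T (of_real (- d - 1))"
  have "\<exists>b. inverse_pair (l *\<^sub>C 1 - ?X) b" if l: "- d \<le> Re l" for l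
  proof -
    have "l \<noteq> of_real (- d - 1)"
      using l by (auto dest: arg_cong[of _ _ Re])
    with inv[OF l] show ?thesis
      using inverse_pair_op_alg_of[OF T] by blast
  qed
  from exp_decay[OF d this] obtain M c where c: "0 < c"
    and M: "\<And>t. 0 \<le> t \<Longrightarrow> norm (exp (t *\<^sub>R ?X)) \<le> M * exp (- c * t)"
    by blast
  have "onorm_max (exp_op t T) \<le> max 1 (real CARD('n) * M) * exp (- c * t)" if "0 \<le> t" for t
  proof -
    have "onorm_max (exp_op t T) \<le> real CARD('n) * norm (op_part (exp (t *\<^sub>R ?X)))"
      using onorm_max_le_norm[of "op_part (exp (t *\<^sub>R ?X))"]
      by (simp add: op_part_exp op_alg_of_simps T)
    also have "\<dots> \<le> real CARD('n) * (M * exp (- c * t))"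
      using M[OF that] by (intro mult_left_mono) (auto simp: norm_op_alg)
    also have "\<dots> = (real CARD('n) * M) * exp (- c * t)"
      by simp
    also have "\<dots> \<le> max 1 (real CARD('n) * M) * exp (- c * t)"
      by (intro mult_right_mono) auto
    finally show ?thesis .
  qed
  with c show ?thesis
    unfolding exponentially_stable_def by (metis max.cobounded1)
qed

text \<open>
  The resolvent is delivered as an element of the operator algebra, so that its continuity in \<open>l\<close> with
  respect to the operator norm is available through \<open>inverse_pair_tendsto\<close>. The adjoined scalar \<open>- 1\<close> limits
  the decay rate of the pair to at most 1.
\<close>

theorem exponentially_stable_resolvent:
  fixes T :: "'x::{complex_normed_vector, banach} ^ 'n \<Rightarrow> 'x ^ 'n"
  assumes T: "bounded_clinear T" and stable: "exponentially_stable T"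
  shows "\<exists>c>0. \<forall>l. - c < Re l \<longrightarrow> (\<exists>X. inverse_pair (l *\<^sub>C 1 - op_alg_of T (- 1)) X)"
proof -
  obtain M g where "1 \<le> M" "0 < g"
    and M: "\<And>t. 0 \<le> t \<Longrightarrow> onorm_max (exp_op t T) \<le> M * exp (- g * t)"
    using stable unfolding exponentially_stable_def by blast
  let ?X = "op_alg_of T (- 1)"
  define c where "c = min g 1"
  have "0 < c"
    using \<open>0 < g\<close> by (simp add: c_def)
  have "norm (exp (t *\<^sub>R ?X)) \<le> real CARD('n) * M * exp (- c * t)" if "0 \<le> t" for t
  proof -
    have "norm (op_part (exp (t *\<^sub>R ?X))) \<le> real CARD('n) * onorm_max (exp_op t T)"
      using norm_le_onorm_max[of "op_part (exp (t *\<^sub>R ?X))"]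
      by (simp add: op_part_exp op_alg_of_simps T)
    also have "\<dots> \<le> real CARD('n) * (M * exp (- g * t))"
      using M[OF that] by (intro mult_left_mono) auto
    also have "\<dots> \<le> real CARD('n) * (M * exp (- c * t))"
      using that \<open>1 \<le> M\<close> by (intro mult_left_mono) (auto simp: c_def mult_right_mono)
    finally have 1: "norm (op_part (exp (t *\<^sub>R ?X))) \<le> real CARD('n) * M * exp (- c * t)"
      by simp
    have "norm (scalar_part (exp (t *\<^sub>R ?X))) = exp (- t)"
      by (simp add: scalar_part_exp op_alg_of_simps)
    also have "\<dots> \<le> 1 * exp (- c * t)"
      using that mult_right_mono[of c 1 t] by (simp add: c_def)
    also have "\<dots> \<le> real CARD('n) * M * exp (- c * t)"
      using \<open>1 \<le> M\<close> mult_mono[of 1 "real CARD('n)" 1 M] by (intro mult_right_mono) auto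
    finally show ?thesis
      using 1 by (simp add: norm_op_alg)
  qed
  then show ?thesis
    using \<open>0 < c\<close> resolvent_of_exp_decay by blast
qed

section \<open>Eigenvalues of matrices depending on a parameter\<close>

lemma continuous_on_det:
  fixes M :: "'a::topological_space \<Rightarrow> complex ^ 'n ^ 'n"
  assumes "\<And>i j. continuous_on S (\<lambda>x. M x $ i $ j)"
  shows "continuous_on S (\<lambda>x. det (M x))"
  unfolding det_def by (intro continuous_intros assms)

text \<open>
  Cramer's rule exhibits the entries of the inverse as quotients of determinants.
\<close>

lemma continuous_on_matrix_inverse:
  fixes M :: "'a::topological_space \<Rightarrow> complex ^ 'n ^ 'n"
  assumes M: "continuous_on S M" and det: "\<And>x. x \<in> S \<Longrightarrow> det (M x) \<noteq> 0"
  shows "\<exists>N. continuous_on S N \<and> (\<forall>x\<in>S. M x ** N x = mat 1 \<and> N x ** M x = mat 1)"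
proof -
  have entry: "continuous_on S (\<lambda>x. M x $ i $ j)" for i j
    by (intro continuous_on_component M)
  define N where "N x = (\<chi> k j. det (\<chi> i l. if l = k then mat 1 $ i $ j else M x $ i $ l) / det (M x))"
    for x
  have "continuous_on S N"
    unfolding N_def
  proof (intro continuous_on_vec_lambda continuous_on_divide continuous_on_det)
    fix k j i l
    show "continuous_on S (\<lambda>x. (\<chi> i l. if l = k then mat 1 $ i $ j else M x $ i $ l) $ i $ l)"
      using entry by (cases "l = k") auto
  qed (use entry det in auto)
  moreover have MN: "M x ** N x = mat 1" if "x \<in> S" for x
  proof -
    have "M x *v column j (N x) = column j (mat 1)" for j
      by (subst cramer[OF det[OF that]]) (simp add: N_def column_def cong: if_cong)
    then show ?thesis
      by (simp add: vec_eq_iff column_def matrix_vector_mult_def matrix_matrix_mult_def)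
  qed
  ultimately show ?thesis
    using matrix_left_right_inverse by blast
qed

text \<open>
  The bilinear pairing, without complex conjugation, so that row vectors act as complex-linear functionals.
\<close>

definition pairing :: "complex ^ 'n \<Rightarrow> complex ^ 'n \<Rightarrow> complex"
  where "pairing w v = (\<Sum>i\<in>UNIV. w $ i * v $ i)"

lemma bounded_bilinear_pairing: "bounded_bilinear pairing"
  unfolding bilinear_conv_bounded_bilinear[symmetric]
  by (auto simp: bilinear_def pairing_def sum.distrib algebra_simps scaleR_sum_right intro!: linearI)

lemma pairing_matrix:
  fixes M :: "complex ^ 'm ^ 'n"
  shows "pairing w (M *v v) = pairing (w v* M) v"
  unfolding pairing_def matrix_vector_mult_def vector_matrix_mult_def
  by (simp add: sum_distrib_left sum_distrib_right) (subst sum.swap, simp add: mult_ac)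

lemma pairing_scaleC_right: "pairing w (c *\<^sub>C v) = c * pairing w v"
  by (simp add: pairing_def scaleC_vec_def scaleC_complex_def sum_distrib_left mult.left_commute)

lemma mat_mult_vec: "mat c *v (v :: complex ^ 'n) = c *\<^sub>C v"
  by (simp add: mat_def matrix_vector_mult_def scaleC_vec_def scaleC_complex_def vec_eq_iff
      if_distrib[of "\<lambda>x. x * _"] sum.delta' cong: if_cong)

lemma left_eigenvector:
  fixes M :: "complex ^ 'n ^ 'n"
  assumes "det (mat l - M) = 0"
  obtains w where "w \<noteq> 0" "\<And>v. pairing w (M *v v) = l * pairing w v"
proof -
  have "det (transpose (mat l - M)) = 0"
    using assms by (simp add: det_transpose)
  then have "\<not> invertible (transpose (mat l - M))"
    by (simp add: invertible_det_nz)
  then obtain w where w: "w \<noteq> 0" "transpose (mat l - M) *v w = 0"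
    unfolding invertible_left_inverse matrix_left_invertible_ker by blast
  interpret bounded_bilinear "pairing :: complex ^ 'n \<Rightarrow> complex ^ 'n \<Rightarrow> complex"
    by (rule bounded_bilinear_pairing)
  have "pairing w ((mat l - M) *v v) = 0" for v
    using w by (simp add: pairing_matrix zero_left)
  then have "pairing w (M *v v) = l * pairing w v" for v
    by (simp add: matrix_vector_mult_diff_rdistrib diff_right mat_mult_vec pairing_scaleC_right)
  with w show ?thesis
    using that by blast
qed

lemma eigenvalue_norm_le:
  obtains K where "\<And>(M :: complex ^ 'n ^ 'n) l. det (mat l - M) = 0 \<Longrightarrow> cmod l \<le> K * norm M"
proof -
  have "bilinear ((*v) :: complex ^ 'n ^ 'n \<Rightarrow> complex ^ 'n \<Rightarrow> complex ^ 'n)"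
    by (auto simp: bilinear_def matrix_vector_mult_def vec_eq_iff sum.distrib algebra_simps
        scaleR_sum_right intro!: linearI)
  then obtain K where K: "\<And>(M :: complex ^ 'n ^ 'n) v. norm (M *v v) \<le> K * norm M * norm v"
    using bilinear_bounded by blast
  have "cmod l \<le> K * norm M" if "det (mat l - M) = 0" for M :: "complex ^ 'n ^ 'n" and l
  proof -
    have "\<not> invertible (mat l - M)"
      using that by (simp add: invertible_det_nz)
    then obtain v where v: "v \<noteq> 0" "(mat l - M) *v v = 0"
      unfolding invertible_left_inverse matrix_left_invertible_ker by blast
    then have "l *\<^sub>C v = M *v v"
      by (simp add: matrix_vector_mult_diff_rdistrib mat_mult_vec)
    then have "cmod l * norm v \<le> K * norm M * norm v"
      using K[of M v] by (metis norm_scaleC)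
    then show ?thesis
      using v by simp
  qed
  then show ?thesis
    using that by blast
qed

text \<open>
  The value \<open>poly p a\<close> is the product of the factors \<open>a - z\<close> over the roots \<open>z\<close> of \<open>p\<close>; if every factor
  has modulus at least \<open>r\<close>, the product has modulus at least \<open>r ^ degree p\<close>.
\<close>

lemma monic_poly_root_near:
  fixes p :: "complex poly"
  assumes "lead_coeff p = 1" "cmod (poly p a) < r ^ degree p" "0 \<le> r"
  obtains z where "cmod (z - a) < r" "poly p z = 0"
proof -
  have "\<exists>z. cmod (z - a) < r \<and> poly p z = 0"
    using assms(1,2)
  proof (induction "degree p" arbitrary: p)
    case 0
    then obtain c where "p = [:c:]"
      by (metis degree_eq_zeroE)
    with 0 show ?case
      by simp
  next
    case (Suc n)
    then have "\<not> constant (poly p)"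
      by (simp add: constant_degree)
    then obtain z where z: "poly p z = 0"
      using fundamental_theorem_of_algebra by blast
    then obtain q where p: "p = [:- z, 1:] * q"
      by (auto simp: poly_eq_0_iff_dvd elim: dvdE)
    have "lead_coeff p = lead_coeff [:- z, 1:] * lead_coeff q"
      unfolding p by (rule lead_coeff_mult)
    then have q: "lead_coeff q = 1" "q \<noteq> 0"
      using Suc.prems(1) by auto
    then have deg: "degree p = Suc (degree q)"
      unfolding p by (subst degree_mult_eq) auto
    have pa: "poly p a = (a - z) * poly q a"
      by (simp add: p algebra_simps)
    show ?case
    proof (cases "cmod (z - a) < r")
      case False
      have "r * cmod (poly q a) \<le> cmod (a - z) * cmod (poly q a)"
        using False by (intro mult_right_mono) (auto simp: norm_minus_commute)
      also have "\<dots> < r * r ^ degree q"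
        using Suc.prems(2) by (simp add: pa deg norm_mult)
      finally have "cmod (poly q a) < r ^ degree q"
        using \<open>0 \<le> r\<close> by (cases "r = 0") auto
      then obtain y where "cmod (y - a) < r" "poly q y = 0"
        using Suc.hyps q(1) deg by auto
      then show ?thesis
        by (auto simp: p simp del: mult_pCons_left)
    qed (use z in blast)
  qed
  with that show ?thesis
    by blast
qed

definition charpoly :: "complex ^ 'n ^ 'n \<Rightarrow> complex poly"
  where "charpoly M = det (\<chi> i j. if i = j then [:- M $ i $ j, 1:] else [:- M $ i $ j:])"

lemma poly_charpoly: "poly (charpoly M) l = det (mat l - M)"
  by (auto simp: charpoly_def det_def poly_sum poly_prod mat_def intro!: sum.cong prod.cong)

text \<open>
  In the Leibniz expansion only the identity permutation contributes a product of full degree: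
  any other permutation picks at least one constant entry.
\<close>

lemma charpoly_monic:
  fixes M :: "complex ^ 'n ^ 'n"
  shows "degree (charpoly M) = CARD('n)" "lead_coeff (charpoly M) = 1"
proof -
  let ?C = "\<lambda>i j. if i = j then [:- M $ i $ j, 1:] else [:- M $ i $ j:]"
  let ?S = "{p. p permutes (UNIV :: 'n set)}"
  define a where "a = (\<Prod>i::'n\<in>UNIV. [:- M $ i $ i, 1:])"
  define b where "b = (\<Sum>p\<in>?S - {id}. of_int (sign p) * (\<Prod>i\<in>UNIV. ?C i (p i)))"
  have "charpoly M = (\<Sum>p\<in>?S. of_int (sign p) * (\<Prod>i\<in>UNIV. ?C i (p i)))"
    by (simp add: charpoly_def det_def)
  also have "\<dots> = a + b"
    unfolding b_def by (subst sum.remove[of _ id]) (auto simp: permutes_id a_def sign_id)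
  finally have ab: "charpoly M = a + b" .
  have a: "degree a = CARD('n)" "lead_coeff a = 1"
  proof -
    show "degree a = CARD('n)"
      unfolding a_def by (subst degree_prod_eq_sum_degree) auto
    show "lead_coeff a = 1"
      unfolding a_def lead_coeff_prod by simp
  qed
  have "degree b < CARD('n)"
    unfolding b_def
  proof (rule degree_sum_less)
    fix p assume "p \<in> ?S - {id}"
    then obtain k where k: "p k \<noteq> k"
      by (auto simp: fun_eq_iff)
    have "degree (of_int (sign p) * (\<Prod>i\<in>UNIV. ?C i (p i))) \<le> degree (\<Prod>i\<in>UNIV. ?C i (p i))"
      by (simp add: sign_def)
    also have "\<dots> \<le> (\<Sum>i\<in>UNIV. degree (?C i (p i)))"
      by (rule degree_prod_sum_le[unfolded o_def]) simp
    also have "\<dots> < (\<Sum>i::'n\<in>UNIV. 1)"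
      using k[symmetric] by (intro sum_strict_mono_ex1) auto
    finally show "degree (of_int (sign p) * (\<Prod>i\<in>UNIV. ?C i (p i))) < CARD('n)"
      by simp
  qed simp
  with a show "degree (charpoly M) = CARD('n)" "lead_coeff (charpoly M) = 1"
    unfolding ab by (simp_all add: degree_add_eq_left coeff_eq_0)
qed

text \<open>
  Quantitative continuity of eigenvalues: if \<open>a\<close> is an eigenvalue of a matrix, the determinant for a nearby
  matrix \<open>M\<close> is small at \<open>a\<close>, and so \<open>M\<close> has an eigenvalue close to \<open>a\<close>.
\<close>

lemma eigenvalue_near:
  fixes M :: "complex ^ 'n ^ 'n"
  assumes "cmod (det (mat a - M)) < r ^ CARD('n)" "0 \<le> r"
  obtains l where "cmod (l - a) < r" "det (mat l - M) = 0"
proof -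
  have "cmod (poly (charpoly M) a) < r ^ degree (charpoly M)"
    using assms by (simp add: charpoly_monic(1) poly_charpoly)
  from monic_poly_root_near[OF charpoly_monic(2) this assms(2)] show ?thesis
    using that by (auto simp: poly_charpoly)
qed

lemma continuous_on_charmat_det:
  fixes A :: "complex \<Rightarrow> complex ^ 'n ^ 'n"
  assumes "continuous_on P A"
  shows "continuous_on (P \<times> UNIV) (\<lambda>(\<theta>, l). det (mat l - A \<theta>))"
proof -
  have "continuous_on (P \<times> UNIV) (\<lambda>x :: complex \<times> complex. A (fst x))"
    by (rule continuous_on_compose2[OF assms]) (auto intro: continuous_intros)
  then have "continuous_on (P \<times> UNIV) (\<lambda>x :: complex \<times> complex. (mat (snd x) - A (fst x)) $ i $ j)" for i j
    by (cases "i = j") (auto simp: mat_def intro!: continuous_intros)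
  then show ?thesis
    unfolding case_prod_unfold by (rule continuous_on_det)
qed

text \<open>
  The pairs \<open>(\<theta>, l)\<close> with \<open>l\<close> an eigenvalue of \<open>A \<theta>\<close> form a compact set, on which the real part of
  \<open>l\<close> attains its maximum.
\<close>

lemma spectral_gap:
  fixes A :: "complex \<Rightarrow> complex ^ 'n ^ 'n"
  assumes "compact P" and A: "continuous_on P A"
    and neg: "\<And>\<theta> l. \<theta> \<in> P \<Longrightarrow> det (mat l - A \<theta>) = 0 \<Longrightarrow> Re l < 0"
  obtains d where "0 < d" "\<And>\<theta> l. \<theta> \<in> P \<Longrightarrow> det (mat l - A \<theta>) = 0 \<Longrightarrow> Re l < - d"
proof -
  obtain K where K: "\<And>(M :: complex ^ 'n ^ 'n) l. det (mat l - M) = 0 \<Longrightarrow> cmod l \<le> K * norm M"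
    using eigenvalue_norm_le by blast
  have "bounded (A ` P)"
    using compact_continuous_image[OF A \<open>compact P\<close>] by (rule compact_imp_bounded)
  then obtain L where L: "\<And>\<theta>. \<theta> \<in> P \<Longrightarrow> norm (A \<theta>) \<le> L"
    unfolding bounded_iff by blast
  define S where "S = {x \<in> P \<times> cball 0 (\<bar>K\<bar> * L). (\<lambda>(\<theta>, l). det (mat l - A \<theta>)) x = 0}"
  have S: "(\<theta>, l) \<in> S" if "\<theta> \<in> P" "det (mat l - A \<theta>) = 0" for \<theta> l
  proof -
    have "cmod l \<le> \<bar>K\<bar> * L"
      using K[OF that(2)] L[OF that(1)]
      by (smt (verit) abs_ge_self mult_left_mono mult_right_mono norm_ge_zero)
    with that show ?thesis
      by (simp add: S_def)
  qed
  have "compact (P \<times> cball (0::complex) (\<bar>K\<bar> * L))"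
    using \<open>compact P\<close> by (intro compact_Times) auto
  moreover have "closedin (top_of_set (P \<times> cball 0 (\<bar>K\<bar> * L))) S"
    unfolding S_def
    by (intro continuous_closedin_preimage_constant continuous_on_subset[OF continuous_on_charmat_det[OF A]]) auto
  ultimately have "compact S"
    by (rule closedin_compact)
  show ?thesis
  proof (cases "S = {}")
    case True
    then show ?thesis
      using S that[of 1] by auto
  next
    case False
    have "continuous_on S (\<lambda>x. Re (snd x))"
      by (intro continuous_intros)
    then obtain x where x: "x \<in> S" "\<And>y. y \<in> S \<Longrightarrow> Re (snd y) \<le> Re (snd x)"
      using continuous_attains_sup[OF \<open>compact S\<close> False] by blast
    have "Re (snd x) < 0"
      using x(1) neg by (auto simp: S_def)
    moreover have "Re l < - (- Re (snd x) / 2)" if "\<theta> \<in> P" "det (mat l - A \<theta>) = 0" for \<theta> l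
      using x(2)[OF S[OF that]] \<open>Re (snd x) < 0\<close> by simp
    ultimately show ?thesis
      using that[of "- Re (snd x) / 2"] by simp
  qed
qed

section \<open>Norm limits of evaluation functionals\<close>

text \<open>
  Functionals \<open>\<phi> k\<close> that are multiplicative for continuous scalar functions and live at points \<open>\<theta> k\<close>
  different from their limit \<open>\<theta>0\<close> cannot approach a nonzero \<open>\<psi>\<close> in norm. For if \<open>a\<close> vanishes at \<open>\<theta>0\<close>, then \<open>\<psi>\<close> vanishes
  on multiples of \<open>a\<close>, so \<open>a (\<theta> k) * \<phi> k g\<close> is of the order of \<open>\<epsilon> k\<close>. Choosing \<open>a\<close> to decay along \<open>\<theta> k\<close> more
  slowly than \<open>\<epsilon> k\<close> yields that \<open>\<phi> k g\<close> tends to 0. A single function \<open>a\<close> serves for all \<open>k\<close>, because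
  multiplication by \<open>a\<close> is not known to be bounded in terms of the supremum of \<open>a\<close>.
\<close>

lemma limit_of_characters_vanishes:
  fixes \<phi> :: "nat \<Rightarrow> 'v::real_normed_vector \<Rightarrow> complex" and \<theta> :: "nat \<Rightarrow> 'c::metric_space"
  assumes \<theta>: "\<theta> \<longlonglongrightarrow> \<theta>0" "\<And>k. \<theta> k \<noteq> \<theta>0"
    and \<epsilon>: "\<epsilon> \<longlonglongrightarrow> 0" "\<And>k g. norm (\<phi> k g - \<psi> g) \<le> \<epsilon> k * norm g"
    and mult: "\<And>a :: 'c \<Rightarrow> real. continuous_on UNIV a \<Longrightarrow>
      \<exists>m. \<forall>k g. \<phi> k (m g) = of_real (a (\<theta> k)) * \<phi> k g"
  shows "\<psi> g = 0"
proof -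
  have lim: "(\<lambda>k. \<phi> k g) \<longlonglongrightarrow> \<psi> g" for g
  proof (rule LIM_zero_cancel, rule Lim_null_comparison)
    show "\<forall>\<^sub>F k in sequentially. norm (\<phi> k g - \<psi> g) \<le> \<epsilon> k * norm g"
      using \<epsilon>(2) by simp
    show "(\<lambda>k. \<epsilon> k * norm g) \<longlonglongrightarrow> 0"
      using tendsto_mult_right[OF \<epsilon>(1), of "norm g"] by simp
  qed
  have "\<exists>n\<ge>k. \<epsilon> n \<le> (1/4) ^ k" for k
  proof -
    have "\<forall>\<^sub>F n in sequentially. \<epsilon> n < (1/4) ^ k"
      using \<epsilon>(1) by (rule order_tendstoD) simp
    then have "\<forall>\<^sub>F n in sequentially. k \<le> n \<and> \<epsilon> n \<le> (1/4) ^ k"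
      using eventually_ge_at_top[of k] by eventually_elim simp
    then show ?thesis
      by (auto simp: eventually_sequentially)
  qed
  then obtain r where r: "\<And>k. k \<le> r k" "\<And>k. \<epsilon> (r k) \<le> (1/4) ^ k"
    by metis
  have r_lim: "filterlim r at_top sequentially"
    using r(1) by (intro filterlim_at_top_mono[OF filterlim_ident]) auto
  \<comment> \<open>The series of the functions \<open>h k\<close> vanishes at \<open>\<theta>0\<close> and is at least \<open>(1/2) ^ k\<close> at \<open>\<theta> (r k)\<close>, while \<open>\<epsilon> (r k)\<close> is at most \<open>(1/4) ^ k\<close>.\<close>
  define h where "h k x = (1/2) ^ k * min 1 (dist x \<theta>0 / dist (\<theta> (r k)) \<theta>0)" for k :: nat and x
  define a where "a x = (\<Sum>k. h k x)" for x
  have h: "0 \<le> h k x" "h k x \<le> (1/2) ^ k" for k x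
    by (simp_all add: h_def mult_left_le)
  have "summable (\<lambda>k. (1/2 :: real) ^ k)"
    by (rule summable_geometric) simp
  then have sum_h: "summable (\<lambda>k. h k x)" for x
    by (rule summable_comparison_test'[where N = 0]) (simp add: h)
  have "uniform_limit UNIV (\<lambda>n x. \<Sum>k<n. h k x) a sequentially"
    unfolding a_def using \<open>summable (\<lambda>k. (1/2 :: real) ^ k)\<close>
    by (intro Weierstrass_m_test[where M = "\<lambda>k. (1/2) ^ k"]) (simp_all add: h)
  moreover have "continuous_on UNIV (\<lambda>x. \<Sum>k<n. h k x)" for n
    unfolding h_def using \<theta>(2) by (intro continuous_intros) simp
  ultimately have cont: "continuous_on UNIV a"
    by (intro uniform_limit_theorem[where F = sequentially]) auto
  then obtain m where m: "\<And>k g. \<phi> k (m g) = of_real (a (\<theta> k)) * \<phi> k g"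
    using mult by blast
  have "(\<lambda>k. a (\<theta> k)) \<longlonglongrightarrow> a \<theta>0"
    using cont \<theta>(1) continuous_on_tendsto_compose[of UNIV a \<theta> \<theta>0 sequentially] by auto
  moreover have "a \<theta>0 = 0"
    by (simp add: a_def h_def)
  ultimately have "(\<lambda>k. of_real (a (\<theta> k)) * \<phi> k g) \<longlonglongrightarrow> of_real 0 * \<psi> g"
    by (intro tendsto_intros lim) simp
  with lim[of "m g"] have \<psi>m: "\<psi> (m g) = 0"
    unfolding m by (auto dest: LIMSEQ_unique)
  have bound: "norm (\<phi> (r k) g) \<le> (1/2) ^ k * norm (m g)" for k
  proof -
    have "h k (\<theta> (r k)) \<le> a (\<theta> (r k))"
      unfolding a_def using sum_le_suminf[OF sum_h, of "{k}"] h by simp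
    then have "(1/2) ^ k \<le> a (\<theta> (r k))"
      using \<theta>(2) by (simp add: h_def)
    then have "(1/2) ^ k * norm (\<phi> (r k) g) \<le> \<bar>a (\<theta> (r k))\<bar> * norm (\<phi> (r k) g)"
      by (intro mult_right_mono) auto
    also have "\<dots> = norm (\<phi> (r k) (m g) - \<psi> (m g))"
      by (simp add: m \<psi>m norm_mult)
    also have "\<dots> \<le> (1/4) ^ k * norm (m g)"
      using \<epsilon>(2)[of "r k" "m g"] r(2)[of k] by (meson mult_right_mono norm_ge_zero order_trans)
    also have "\<dots> = (1/2) ^ k * ((1/2) ^ k * norm (m g))"
      by (simp add: power_mult_distrib[symmetric] flip: mult.assoc)
    finally show ?thesis
      by simp
  qed
  have "(\<lambda>k. (1/2) ^ k * norm (m g)) \<longlonglongrightarrow> 0 * norm (m g)"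
    by (intro tendsto_intros LIMSEQ_power_zero) simp
  then have "(\<lambda>k. (1/2) ^ k * norm (m g)) \<longlonglongrightarrow> 0"
    by simp
  then have "(\<lambda>k. \<phi> (r k) g) \<longlonglongrightarrow> 0"
    by (rule Lim_null_comparison[OF always_eventually, rotated]) (simp add: bound)
  moreover have "(\<lambda>k. \<phi> (r k) g) \<longlonglongrightarrow> \<psi> g"
    using filterlim_compose[OF lim r_lim] .
  ultimately show ?thesis
    by (rule LIMSEQ_unique[symmetric])
qed

section \<open>Stability of an ensemble from the eigenvalues of its matrices\<close>

context separable_banach_function_space
begin

lemma vec_ev_add: "\<theta> \<in> P \<Longrightarrow> vec_ev ev (f + g) \<theta> = vec_ev ev f \<theta> + vec_ev ev g \<theta>"
  by (simp add: vec_ev_def vec_eq_iff ev_add)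

lemma vec_ev_scaleC: "\<theta> \<in> P \<Longrightarrow> vec_ev ev (c *\<^sub>C f) \<theta> = c *\<^sub>C vec_ev ev f \<theta>"
  by (simp add: vec_ev_def vec_eq_iff ev_scaleC scaleC_vec_def scaleC_complex_def)

lemma vec_ev_diff: "\<theta> \<in> P \<Longrightarrow> vec_ev ev (f - g) \<theta> = vec_ev ev f \<theta> - vec_ev ev g \<theta>"
  using vec_ev_add[of \<theta> "f - g" g] by simp

text \<open>
  Multiplication by the continuous function \<open>(l - A(\<theta>))\<^sup>-\<^sup>1\<close> inverts \<open>l - A\<close>, since both compositions can be
  compared with the identity pointwise.
\<close>

lemma exponentially_stable_of_eigenvalues:
  fixes A :: "complex \<Rightarrow> complex ^ 'n ^ 'n"
  assumes "compact P" and A: "continuous_on P A"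
    and mult: "\<And>A' :: complex \<Rightarrow> complex ^ 'n ^ 'n. continuous_on P A' \<Longrightarrow> bounded_multiplier P ev A'"
    and neg: "\<And>\<theta> l. \<theta> \<in> P \<Longrightarrow> det (mat l - A \<theta>) = 0 \<Longrightarrow> Re l < 0"
  shows "exponentially_stable (mult_op P ev A)"
proof -
  obtain d where d: "0 < d" and gap: "\<And>\<theta> l. \<theta> \<in> P \<Longrightarrow> det (mat l - A \<theta>) = 0 \<Longrightarrow> Re l < - d"
    by (rule spectral_gap[OF \<open>compact P\<close> A]) (use neg in blast)+
  show ?thesis
  proof (rule exponentially_stableI)
    show "bounded_clinear (mult_op P ev A)"
      using mult[OF A] by (simp add: bounded_multiplier_def)
    show "0 < d" by (rule d)
  next
    fix l :: complex assume l: "- d \<le> Re l"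
    have "continuous_on P (\<lambda>\<theta>. mat l - A \<theta>)"
      by (intro continuous_intros A)
    moreover have "det (mat l - A \<theta>) \<noteq> 0" if "\<theta> \<in> P" for \<theta>
      using gap[OF that] l by (meson not_le)
    ultimately have "\<exists>N. continuous_on P N \<and>
        (\<forall>\<theta>\<in>P. (mat l - A \<theta>) ** N \<theta> = mat 1 \<and> N \<theta> ** (mat l - A \<theta>) = mat 1)"
      by (rule continuous_on_matrix_inverse)
    then obtain N where N: "continuous_on P N"
      and inv: "\<And>\<theta>. \<theta> \<in> P \<Longrightarrow> (mat l - A \<theta>) ** N \<theta> = mat 1" "\<And>\<theta>. \<theta> \<in> P \<Longrightarrow> N \<theta> ** (mat l - A \<theta>) = mat 1"
      by blast
    let ?R = "mult_op P ev N"
    have "l *\<^sub>C ?R x - mult_op P ev A (?R x) = x" for x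
    proof (rule vec_ev_inject)
      fix \<theta> assume \<theta>: "\<theta> \<in> P"
      then have "vec_ev ev (l *\<^sub>C ?R x - mult_op P ev A (?R x)) \<theta>
          = (mat l - A \<theta>) *v (N \<theta> *v vec_ev ev x \<theta>)"
        by (simp add: vec_ev_diff vec_ev_scaleC vec_ev_mult_op mult N A mat_mult_vec
            matrix_vector_mult_diff_rdistrib)
      then show "vec_ev ev (l *\<^sub>C ?R x - mult_op P ev A (?R x)) \<theta> = vec_ev ev x \<theta>"
        by (simp add: matrix_vector_mul_assoc inv \<theta>)
    qed
    moreover have "?R (l *\<^sub>C x - mult_op P ev A x) = x" for x
    proof (rule vec_ev_inject)
      fix \<theta> assume \<theta>: "\<theta> \<in> P"
      then have "vec_ev ev (?R (l *\<^sub>C x - mult_op P ev A x)) \<theta>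
          = N \<theta> *v ((mat l - A \<theta>) *v vec_ev ev x \<theta>)"
        by (simp add: vec_ev_diff vec_ev_scaleC vec_ev_mult_op mult N A mat_mult_vec
            matrix_vector_mult_diff_rdistrib)
      then show "vec_ev ev (?R (l *\<^sub>C x - mult_op P ev A x)) \<theta> = vec_ev ev x \<theta>"
        by (simp add: matrix_vector_mul_assoc inv \<theta>)
    qed
    ultimately show "\<exists>R. bounded_clinear R \<and> (\<forall>x. l *\<^sub>C R x - mult_op P ev A (R x) = x) \<and>
        (\<forall>x. R (l *\<^sub>C x - mult_op P ev A x) = x)"
      using mult[OF N] unfolding bounded_multiplier_def by blast
  qed
qed

end

section \<open>Feedback of finite rank cannot stabilise\<close>

lemma bounded_clinear_control_op: "bounded_clinear (control_op B)"
proof -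
  have "linear (control_op B)"
    by (rule linearI) (auto simp: control_op_def vec_eq_iff scaleC_add_left sum.distrib
        scaleR_sum_right bounded_bilinear.scaleR_left[OF bounded_bilinear_scaleC])
  moreover have "control_op B (c *\<^sub>C v) = c *\<^sub>C control_op B v" for c v
    by (simp add: control_op_def vec_eq_iff scaleC_vec_def scaleC_complex_def scaleC_sum_right
        scaleC_scaleC)
  ultimately show ?thesis
    by (simp add: bounded_clinear_def linear_conv_bounded_linear)
qed

lemma bounded_clinear_add_compose:
  assumes "bounded_clinear S" "bounded_clinear T" "bounded_clinear U"
  shows "bounded_clinear (\<lambda>x. S x + T (U x))"
  using assms by (auto simp: bounded_clinear_def scaleC_add_right
      intro!: bounded_linear_add bounded_linear_compose[of T])

text \<open>
  A point of \<open>P\<close> near \<open>\<theta>0\<close> and different from it is moved slightly to one at which some function does not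
  vanish, so that evaluation there is a nonzero functional.
\<close>

lemma (in separable_banach_function_space) eigenvalues_near_limit_point:
  fixes A :: "complex \<Rightarrow> complex ^ 'n ^ 'n"
  assumes A: "continuous_on P A" and dense: "nonvanishing_densely P ev"
    and \<theta>0: "\<theta>0 \<in> P" "\<theta>0 islimpt P" and l0: "det (mat l0 - A \<theta>0) = 0" and "0 < r"
  shows "\<exists>\<theta> l. \<theta> \<in> P \<and> \<theta> \<noteq> \<theta>0 \<and> dist \<theta> \<theta>0 < r \<and> (\<exists>f. ev f \<theta> \<noteq> 0) \<and>
    cmod (l - l0) < r \<and> det (mat l - A \<theta>) = 0"
proof -
  have "continuous_on P (\<lambda>\<theta>. (\<theta>, l0))"
    by (intro continuous_intros)
  from continuous_on_compose2[OF continuous_on_charmat_det[OF A] this]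
  have "continuous_on P (\<lambda>\<theta>. det (mat l0 - A \<theta>))"
    by (simp add: image_subset_iff)
  then obtain d where "0 < d"
    and d: "\<And>\<theta>. \<theta> \<in> P \<Longrightarrow> dist \<theta> \<theta>0 < d \<Longrightarrow> dist (det (mat l0 - A \<theta>)) (det (mat l0 - A \<theta>0)) < r ^ CARD('n)"
    using \<theta>0(1) \<open>0 < r\<close> unfolding continuous_on_iff by (metis zero_less_power)
  define e where "e = min d r"
  have "0 < e"
    using \<open>0 < d\<close> \<open>0 < r\<close> by (simp add: e_def)
  then obtain \<theta>' where \<theta>': "\<theta>' \<in> P" "\<theta>' \<noteq> \<theta>0" "dist \<theta>' \<theta>0 < e"
    using \<theta>0(2) unfolding islimpt_approachable by blast
  have "\<theta>' \<in> closure {\<theta> \<in> P. \<exists>f. ev f \<theta> \<noteq> 0}"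
    using dense \<theta>'(1) unfolding nonvanishing_densely_def by blast
  moreover have "0 < min (dist \<theta>' \<theta>0) (e - dist \<theta>' \<theta>0)"
    using \<theta>' by simp
  ultimately obtain \<theta> where \<theta>: "\<theta> \<in> P" "\<exists>f. ev f \<theta> \<noteq> 0" "dist \<theta> \<theta>' < min (dist \<theta>' \<theta>0) (e - dist \<theta>' \<theta>0)"
    unfolding closure_approachable by blast
  then have "\<theta> \<noteq> \<theta>0"
    by (auto simp: dist_commute)
  have "dist \<theta> \<theta>0 < e"
    using \<theta>(3) dist_triangle[of \<theta> \<theta>0 \<theta>'] by simp
  then have "cmod (det (mat l0 - A \<theta>)) < r ^ CARD('n)"
    using d[OF \<theta>(1)] l0 by (simp add: e_def dist_norm)
  then obtain l where "cmod (l - l0) < r" "det (mat l - A \<theta>) = 0"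
    using eigenvalue_near \<open>0 < r\<close> by (metis less_imp_le)
  with \<theta> \<open>\<theta> \<noteq> \<theta>0\<close> \<open>dist \<theta> \<theta>0 < e\<close> show ?thesis
    by (auto simp: e_def)
qed

text \<open>
  The projection of \<open>b\<close> to the orthogonal complement of \<open>N\<close>, scaled to the unit sphere. Unit vectors orthogonal to
  \<open>N\<close> form a compact set that avoids \<open>N\<close>, so a limit of them stays outside \<open>N\<close>.
\<close>

lemma orthogonal_normalisation:
  fixes b :: "'a::euclidean_space"
  assumes "subspace N" "b \<notin> N"
  obtains z and s :: real where "norm z = 1" "\<And>y. y \<in> N \<Longrightarrow> z \<bullet> y = 0" "z - s *\<^sub>R b \<in> N"
proof -
  obtain y z where yz: "y \<in> span N" "\<And>w. w \<in> span N \<Longrightarrow> orthogonal z w" "b = y + z"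
    using orthogonal_subspace_decomp_exists by blast
  have "y \<in> N"
    using yz(1) assms(1) by (metis span_eq_iff)
  then have "z \<noteq> 0"
    using yz(3) assms(2) by auto
  show ?thesis
  proof
    show "norm (z /\<^sub>R norm z) = 1"
      using \<open>z \<noteq> 0\<close> by simp
    show "(z /\<^sub>R norm z) \<bullet> w = 0" if "w \<in> N" for w
      using yz(2)[OF span_base[OF that]] by (simp add: orthogonal_def)
    have "z /\<^sub>R norm z - inverse (norm z) *\<^sub>R b = - inverse (norm z) *\<^sub>R y"
      by (simp add: yz(3) algebra_simps)
    then show "z /\<^sub>R norm z - inverse (norm z) *\<^sub>R b \<in> N"
      using \<open>y \<in> N\<close> assms(1) by (metis subspace_scale)
  qed
qed

text \<open>
  The functionals \<open>pairing (w k) (vec_ev ev g (\<theta> k))\<close> are rewritten as \<open>- pairing (b k) (F (R (l k) g))\<close>.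
  Here \<open>N\<close> is the set of vectors \<open>b\<close> that annihilate the range of \<open>F\<close>. Replacing \<open>b k\<close> by a unit vector
  orthogonal to \<open>N\<close> only rescales the functional, and a limit \<open>z0\<close> of these vectors gives the norm limit
  \<open>\<psi>\<close>. As \<open>R l0\<close> is onto, \<open>\<psi> = 0\<close> would put \<open>z0\<close> into \<open>N\<close>.
\<close>

theorem (in separable_banach_function_space) closed_loop_not_stable:
  fixes A :: "complex \<Rightarrow> complex ^ 'n ^ 'n" and B :: "'x ^ 'm ^ 'n" and F :: "'x ^ 'n \<Rightarrow> complex ^ 'm"
  assumes A: "continuous_on P A" and dense: "nonvanishing_densely P ev"
    and mult: "\<And>A' :: complex \<Rightarrow> complex ^ 'n ^ 'n. continuous_on P A' \<Longrightarrow> bounded_multiplier P ev A'"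
    and \<theta>0: "\<theta>0 \<in> P" "\<theta>0 islimpt P" and l0: "det (mat l0 - A \<theta>0) = 0" "0 \<le> Re l0"
    and F: "bounded_clinear F"
  shows "\<not> exponentially_stable (\<lambda>x. mult_op P ev A x + control_op B (F x))"
proof
  let ?T = "\<lambda>x. mult_op P ev A x + control_op B (F x)"
  assume stable: "exponentially_stable ?T"
  have T: "bounded_clinear ?T"
    using mult[OF A] F by (intro bounded_clinear_add_compose bounded_clinear_control_op)
      (auto simp: bounded_multiplier_def)
  obtain c where "0 < c"
    and "\<forall>l. - c < Re l \<longrightarrow> (\<exists>X. inverse_pair (l *\<^sub>C 1 - op_alg_of ?T (- 1)) X)"
    using exponentially_stable_resolvent[OF T stable] by blast
  then obtain X where X: "\<And>l. - c < Re l \<Longrightarrow> inverse_pair (l *\<^sub>C 1 - op_alg_of ?T (- 1)) (X l)"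
    by metis
  define R where "R l = op_part (X l)" for l
  have R: "l *\<^sub>C R l x - ?T (R l x) = x" "R l (l *\<^sub>C x - ?T x) = x" if "- c < Re l" for l x
    using op_part_inverse_pair[OF T X[OF that]] by (simp_all add: R_def)
  \<comment> \<open>The bound \<open>c\<close> keeps the eigenvalues \<open>l k\<close> in the half plane where the resolvent exists.\<close>
  have "\<exists>\<theta> l. \<theta> \<in> P \<and> \<theta> \<noteq> \<theta>0 \<and> dist \<theta> \<theta>0 < min c (inverse (Suc k)) \<and> (\<exists>f. ev f \<theta> \<noteq> 0) \<and>
      cmod (l - l0) < min c (inverse (Suc k)) \<and> det (mat l - A \<theta>) = 0" for k
    using \<open>0 < c\<close> by (intro eigenvalues_near_limit_point A dense \<theta>0 l0) auto
  then obtain \<theta> l where \<theta>: "\<And>k. \<theta> k \<in> P" "\<And>k. \<theta> k \<noteq> \<theta>0" "\<And>k. dist (\<theta> k) \<theta>0 < inverse (Suc k)"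
      "\<And>k. \<exists>f. ev f (\<theta> k) \<noteq> 0"
    and l: "\<And>k. cmod (l k - l0) < c" "\<And>k. cmod (l k - l0) < inverse (Suc k)"
      "\<And>k. det (mat (l k) - A (\<theta> k)) = 0"
    unfolding min_less_iff_conj by metis
  have \<theta>_lim: "\<theta> \<longlonglongrightarrow> \<theta>0"
    by (rule metric_tendsto_imp_tendsto[OF LIMSEQ_inverse_real_of_nat])
       (auto intro!: always_eventually less_imp_le \<theta> simp del: of_nat_Suc)
  have l_lim: "l \<longlonglongrightarrow> l0"
    by (rule metric_tendsto_imp_tendsto[OF LIMSEQ_inverse_real_of_nat])
       (auto intro!: always_eventually less_imp_le l simp: dist_norm simp del: of_nat_Suc)
  have lc: "- c < Re (l k)" for k
    using l(1)[of k] abs_Re_le_cmod[of "l k - l0"] l0(2) by simp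
  have l0c: "- c < Re l0"
    using l0(2) \<open>0 < c\<close> by simp
  have "\<exists>w. w \<noteq> 0 \<and> (\<forall>v. pairing w (A (\<theta> k) *v v) = l k * pairing w v)" for k
    using left_eigenvector[OF l(3)] by metis
  then obtain w where w: "\<And>k. w k \<noteq> 0" "\<And>k v. pairing (w k) (A (\<theta> k) *v v) = l k * pairing (w k) v"
    by metis
  interpret pairing_n: bounded_bilinear "pairing :: complex ^ 'n \<Rightarrow> complex ^ 'n \<Rightarrow> complex"
    by (rule bounded_bilinear_pairing)
  interpret pairing_m: bounded_bilinear "pairing :: complex ^ 'm \<Rightarrow> complex ^ 'm \<Rightarrow> complex"
    by (rule bounded_bilinear_pairing)
  define b where "b k = w k v* mat_ev ev B (\<theta> k)" for k
  have eval: "pairing (w k) (vec_ev ev g (\<theta> k)) = - pairing (b k) (F (R (l k) g))" for k g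
  proof -
    let ?x = "R (l k) g"
    have "vec_ev ev g (\<theta> k) = vec_ev ev (l k *\<^sub>C ?x - ?T ?x) (\<theta> k)"
      by (simp add: R lc)
    also have "\<dots> = l k *\<^sub>C vec_ev ev ?x (\<theta> k) -
        (A (\<theta> k) *v vec_ev ev ?x (\<theta> k) + mat_ev ev B (\<theta> k) *v F ?x)"
      using \<theta>(1) by (simp add: vec_ev_diff vec_ev_add vec_ev_scaleC vec_ev_mult_op mult A vec_ev_control_op)
    finally show ?thesis
      by (simp add: pairing_n.diff_right pairing_n.add_right pairing_scaleC_right w b_def
          pairing_matrix[of _ "mat_ev ev B (\<theta> k)"])
  qed
  define N where "N = {b. \<forall>x. pairing b (F x) = 0}"
  have N: "subspace N"
    by (auto simp: subspace_def N_def pairing_m.zero_left pairing_m.add_left pairing_m.scaleR_left)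
  have "b k \<notin> N" for k
  proof
    assume "b k \<in> N"
    then have 0: "pairing (w k) (vec_ev ev g (\<theta> k)) = 0" for g
      unfolding eval by (simp add: N_def)
    obtain f where f: "ev f (\<theta> k) \<noteq> 0"
      using \<theta>(4) by blast
    obtain j where j: "w k $ j \<noteq> 0"
      using w(1)[of k] by (auto simp: vec_eq_iff)
    have "vec_ev ev (axis j f) (\<theta> k) = axis j (ev f (\<theta> k))"
      using \<theta>(1) by (simp add: vec_ev_def axis_def vec_eq_iff ev_zero)
    then have "w k $ j * ev f (\<theta> k) = 0"
      using 0[of "axis j f"]
      by (simp add: pairing_def axis_def if_distrib[of "\<lambda>x. _ * x"] cong: if_cong)
    with f j show False
      by simp
  qed
  then have "\<exists>z s. norm z = 1 \<and> (\<forall>y\<in>N. z \<bullet> y = 0) \<and> z - s *\<^sub>R b k \<in> N" for k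
    using orthogonal_normalisation[OF N] by metis
  then obtain z s where z: "\<And>k. norm (z k) = 1" "\<And>k y. y \<in> N \<Longrightarrow> z k \<bullet> y = 0"
      "\<And>k. z k - s k *\<^sub>R b k \<in> N"
    by metis
  have "\<forall>k. z k \<in> sphere 0 1"
    using z(1) by simp
  then obtain z0 q where z0: "z0 \<in> sphere 0 1" and q: "strict_mono q" and z_lim: "(z \<circ> q) \<longlonglongrightarrow> z0"
    using compact_imp_seq_compact[OF compact_sphere] unfolding seq_compact_def by metis
  define \<phi> where "\<phi> k g = pairing (z (q k)) (F (R (l (q k)) g))" for k g
  define \<psi> where "\<psi> g = pairing z0 (F (R l0 g))" for g
  have \<phi>: "\<phi> k g = - (s (q k) *\<^sub>R pairing (w (q k)) (vec_ev ev g (\<theta> (q k))))" for k g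
  proof -
    have "pairing (z (q k) - s (q k) *\<^sub>R b (q k)) (F (R (l (q k)) g)) = 0"
      using z(3) by (simp add: N_def)
    then show ?thesis
      by (simp add: \<phi>_def eval pairing_m.diff_left pairing_m.scaleR_left)
  qed
  have X_lim: "(\<lambda>k. X (l (q k))) \<longlonglongrightarrow> X l0"
  proof (rule inverse_pair_tendsto)
    show "(\<lambda>k. l (q k) *\<^sub>C 1 - op_alg_of ?T (- 1)) \<longlonglongrightarrow> l0 *\<^sub>C 1 - op_alg_of ?T (- 1)"
      using LIMSEQ_subseq_LIMSEQ[OF l_lim q]
      by (intro tendsto_intros bounded_bilinear.tendsto[OF bounded_bilinear_scaleC]) (simp add: o_def)
  qed (use X lc l0c in auto)
  have R_lim: "(\<lambda>k. R (l (q k))) \<longlonglongrightarrow> R l0"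
    unfolding R_def by (rule bounded_linear.tendsto[OF bounded_linear_op_part X_lim])
  obtain Kp where Kp: "0 \<le> Kp" "\<And>u v :: complex ^ 'm. norm (pairing u v) \<le> norm u * norm v * Kp"
    using pairing_m.nonneg_bounded by blast
  have F_lin: "bounded_linear F"
    using F by (simp add: bounded_clinear_def)
  obtain KF where KF: "0 \<le> KF" "\<And>x. norm (F x) \<le> norm x * KF"
    using bounded_linear.nonneg_bounded[OF F_lin] by blast
  have pF: "norm (pairing u (F (blinfun_apply S g))) \<le> norm u * (norm S * norm g * KF) * Kp" for u S g
  proof -
    have "norm (F (blinfun_apply S g)) \<le> norm S * norm g * KF"
      using KF(2)[of "S g"] mult_right_mono[OF norm_blinfun KF(1)] order_trans by blast
    then show ?thesis
      using Kp(2)[of u "F (S g)"]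
      by (meson Kp(1) mult_left_mono mult_right_mono norm_ge_zero order_trans)
  qed
  define \<epsilon> where "\<epsilon> k = Kp * KF * (norm (z (q k) - z0) * norm (R (l (q k))) + norm (R (l (q k)) - R l0))" for k
  have "\<psi> g = 0" for g
  proof (rule limit_of_characters_vanishes[where \<phi> = \<phi> and \<theta> = "\<lambda>k. \<theta> (q k)" and \<epsilon> = \<epsilon>])
    show "(\<lambda>k. \<theta> (q k)) \<longlonglongrightarrow> \<theta>0"
      using LIMSEQ_subseq_LIMSEQ[OF \<theta>_lim q] by (simp add: o_def)
    show "\<theta> (q k) \<noteq> \<theta>0" for k
      by (rule \<theta>(2))
    have "\<epsilon> \<longlonglongrightarrow> Kp * KF * (norm (z0 - z0) * norm (R l0) + norm (R l0 - R l0))"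
      unfolding \<epsilon>_def using z_lim by (intro tendsto_intros R_lim) (simp add: o_def)
    then show "\<epsilon> \<longlonglongrightarrow> 0"
      by simp
    show "norm (\<phi> k g - \<psi> g) \<le> \<epsilon> k * norm g" for k g
    proof -
      have "\<phi> k g - \<psi> g = pairing (z (q k) - z0) (F (R (l (q k)) g)) + pairing z0 (F ((R (l (q k)) - R l0) g))"
        by (simp add: \<phi>_def \<psi>_def pairing_m.diff_left blinfun.diff_left
            linear_diff bounded_linear.linear F_lin pairing_m.diff_right)
      also have "norm \<dots> \<le> norm (z (q k) - z0) * (norm (R (l (q k))) * norm g * KF) * Kp +
          norm z0 * (norm (R (l (q k)) - R l0) * norm g * KF) * Kp"
        by (intro norm_triangle_mono pF)
      also have "\<dots> = \<epsilon> k * norm g"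
        using z0 by (simp add: \<epsilon>_def algebra_simps)
      finally show ?thesis .
    qed
    fix a :: "complex \<Rightarrow> real"
    assume a: "continuous_on UNIV a"
    let ?M = "\<lambda>\<theta>. mat (of_real (a \<theta>)) :: complex ^ 'n ^ 'n"
    have "continuous_on P (\<lambda>\<theta>. if i = j then complex_of_real (a \<theta>) else 0)" for i j :: 'n
      using continuous_on_subset[OF a, of P] by (cases "i = j") (auto intro: continuous_intros)
    then have "continuous_on P ?M"
      unfolding mat_def by (intro continuous_on_vec_lambda)
    then have "vec_ev ev (mult_op P ev ?M g) (\<theta> (q k)) = of_real (a (\<theta> (q k))) *\<^sub>C vec_ev ev g (\<theta> (q k))" for k g
      using \<theta>(1) by (simp add: vec_ev_mult_op mult mat_mult_vec)
    then have "\<phi> k (mult_op P ev ?M g) = of_real (a (\<theta> (q k))) * \<phi> k g" for k g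
      by (simp add: \<phi> pairing_scaleC_right)
    then show "\<exists>m. \<forall>k g. \<phi> k (m g) = of_real (a (\<theta> (q k))) * \<phi> k g"
      by blast
  qed
  then have "pairing z0 (F x) = 0" for x
    using R(2)[OF l0c, of x] unfolding \<psi>_def by metis
  then have "z0 \<in> N"
    by (simp add: N_def)
  have "(\<lambda>k. (z \<circ> q) k \<bullet> z0) \<longlonglongrightarrow> z0 \<bullet> z0"
    by (intro tendsto_intros z_lim)
  moreover have "(z \<circ> q) k \<bullet> z0 = 0" for k
    using z(2)[OF \<open>z0 \<in> N\<close>] by simp
  ultimately have "z0 \<bullet> z0 = 0"
    using LIMSEQ_unique tendsto_const by fastforce
  with z0 show False
    by simp
qed

theorem theorem3p4:
  fixes P :: "complex set"
    and ev :: "'x::{complex_normed_vector, banach, second_countable_topology} \<Rightarrow> complex \<Rightarrow> complex"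
    and A :: "complex \<Rightarrow> complex ^ 'n ^ 'n"
    and B :: "'x ^ 'm ^ 'n"
  assumes "compact P" and "P \<noteq> {}"
    and "separable_banach_function_space P ev"
    and "nonvanishing_densely P ev"
    and "\<And>A' :: complex \<Rightarrow> complex ^ 'n ^ 'n. continuous_on P A' \<Longrightarrow> bounded_multiplier P ev A'"
    and perfect: "\<forall>\<theta>\<in>P. \<theta> islimpt P"
    and "continuous_on P A"
    and "\<not> exponentially_stable (mult_op P ev A)"
  shows "\<not> exponentially_stabilizable P ev A B"
proof -
  interpret separable_banach_function_space P ev
    by fact
  obtain \<theta>0 l0 where "\<theta>0 \<in> P" "det (mat l0 - A \<theta>0) = 0" "0 \<le> Re l0"
    using exponentially_stable_of_eigenvalues[OF assms(1,7,5)] assms(8) by (meson not_le)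
  then show ?thesis
    unfolding exponentially_stabilizable_def
    using closed_loop_not_stable[OF assms(7,4,5)] perfect by blast
qed

end
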